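(* For $0\le t\le\pi/3$ let $\mathcal{E}_t$ be the axis-aligned ellipse with center $O_t=(0,-\sin t)$, horizontal semi-axis $a=\frac{\sqrt{2\cos t-1}}{2}$ and vertical semi-axis $b=\frac{\sqrt{(2\cos t-1)(1-\cos t)}}{\sqrt2}$, and let $f_{1,t},f_{2,t}$ be its foci. Then there is a continuous family of Brocard porisms $\mathcal{B}_t=(\Gamma_t,\mathcal{E}_t)$ whose one-parameter family of triangles (3-periodics): (i) is inscribed in the circle $\Gamma_t$ with center $X_{3,t}=\left(0,\frac{\sin t}{2(\cos t-1)}\right)$ and radius $R_t=\sqrt{\frac{2\cos t-1}{2(1-\cos t)}}$; (ii) circumscribes $\mathcal{E}_t$, its Brocard inellipse (i.e. its Brocard points $\Omega_{1,t},\Omega_{2,t}$ are $f_{1,t},f_{2,t}$); (iii) has fixed isodynamic points $X_{15}=(0,-\sqrt3/2)$ and $X_{16}=(0,\sqrt3/2)$; (iv) has fixed Brocard angle $\omega_t=t/2$; (v) has Brocard circle $\mathcal{K}_t$ with center $X_{182,t}=\left(0,\frac{\cos t-2}{2\sin t}\right)$ and radius $\rho_t=\frac{2\cos t-1}{2\sin t}$.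
   Context: For a triangle $ABC$ with vertices labelled counterclockwise, the Brocard angle $\omega$ and Brocard points $\Omega_1,\Omega_2$ are defined by $\angle\Omega_1AB=\angle\Omega_1BC=\angle\Omega_1CA=\omega$ and $\angle\Omega_2BA=\angle\Omega_2CB=\angle\Omega_2AC=\omega$. $X_3$ is the circumcenter. The Brocard circle is the circle through $X_3,\Omega_1,\Omega_2$; its center is denoted $X_{182}$. The Brocard inellipse is the ellipse tangent to the three sides with foci $\Omega_1,\Omega_2$. The isodynamic points are the two common points of the three Apollonius circles of the triangle; $X_{15}$ is the one inside the circumcircle and $X_{16}$ is its inverse in the circumcircle. A Brocard porism is the pair $(\Gamma,\mathcal{E})$ of circumcircle and Brocard inellipse of a triangle; its 3-periodics are all triangles inscribed in $\Gamma$ and circumscribed about $\mathcal{E}$.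
   Formalization: The porism claim and (i)–(v) are stated for 0<t<π/3 only: at t=0 the formulas for X_3, R, X_182, ρ divide by zero, and at t=π/3 the circle and ellipse shrink to a point, so there is no triangle; continuity is stated up to the endpoints where defined. *)

theory Defs
  imports "HOL-Analysis.Analysis"
begin

(* The Euclidean plane is the type complex; the point (x, y) is Complex x y. *)

definition ccw_triangle :: "complex \<Rightarrow> complex \<Rightarrow> complex \<Rightarrow> bool" where
  "ccw_triangle A B C \<longleftrightarrow> Im (cnj (B - A) * (C - A)) > 0"

(* Oriented angle in (-pi, pi] through which the ray YX has to be turned counterclockwise
   about Y to reach the ray YZ. *)
definition oangle :: "complex \<Rightarrow> complex \<Rightarrow> complex \<Rightarrow> real" where
  "oangle X Y Z = Arg ((Z - Y) / (X - Y))"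

definition circumcenter :: "complex \<Rightarrow> complex \<Rightarrow> complex \<Rightarrow> complex" where
  "circumcenter A B C = (THE X. dist X A = dist X B \<and> dist X B = dist X C)"

definition circumcircle :: "complex \<Rightarrow> complex \<Rightarrow> complex \<Rightarrow> complex set" where
  "circumcircle A B C = sphere (circumcenter A B C) (dist (circumcenter A B C) A)"

(* The defining angle conditions are read as oriented angles: the triangle lies to the left of
   each of its directed sides AB, BC, CA.  With unoriented angles, points outside the triangle
   could satisfy the conditions as well. *)

definition is_brocard_point1 ::
    "complex \<Rightarrow> complex \<Rightarrow> complex \<Rightarrow> real \<Rightarrow> complex \<Rightarrow> bool" where
  "is_brocard_point1 A B C w P \<longleftrightarrow>
     oangle B A P = w \<and> oangle C B P = w \<and> oangle A C P = w"

definition is_brocard_point2 ::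
    "complex \<Rightarrow> complex \<Rightarrow> complex \<Rightarrow> real \<Rightarrow> complex \<Rightarrow> bool" where
  "is_brocard_point2 A B C w P \<longleftrightarrow>
     oangle P B A = w \<and> oangle P C B = w \<and> oangle P A C = w"

definition brocard_angle :: "complex \<Rightarrow> complex \<Rightarrow> complex \<Rightarrow> real" where
  "brocard_angle A B C =
     (THE w. (\<exists>P. is_brocard_point1 A B C w P) \<and> (\<exists>P. is_brocard_point2 A B C w P))"

definition brocard_point1 :: "complex \<Rightarrow> complex \<Rightarrow> complex \<Rightarrow> complex" where
  "brocard_point1 A B C = (THE P. is_brocard_point1 A B C (brocard_angle A B C) P)"

definition brocard_point2 :: "complex \<Rightarrow> complex \<Rightarrow> complex \<Rightarrow> complex" where
  "brocard_point2 A B C = (THE P. is_brocard_point2 A B C (brocard_angle A B C) P)"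

definition brocard_circle :: "complex \<Rightarrow> complex \<Rightarrow> complex \<Rightarrow> complex set" where
  "brocard_circle A B C =
     circumcircle (circumcenter A B C) (brocard_point1 A B C) (brocard_point2 A B C)"

definition X182 :: "complex \<Rightarrow> complex \<Rightarrow> complex \<Rightarrow> complex" where
  "X182 A B C =
     circumcenter (circumcenter A B C) (brocard_point1 A B C) (brocard_point2 A B C)"

(* The Apollonius circle through the vertex A, written as the locus PB : PC = AB : AC.
   If AB = AC it degenerates to the perpendicular bisector of BC. *)
definition apollonius_circle :: "complex \<Rightarrow> complex \<Rightarrow> complex \<Rightarrow> complex set" where
  "apollonius_circle A B C = {P. dist P B * dist A C = dist P C * dist A B}"

definition isodynamic_points :: "complex \<Rightarrow> complex \<Rightarrow> complex \<Rightarrow> complex set" where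
  "isodynamic_points A B C =
     apollonius_circle A B C \<inter> apollonius_circle B C A \<inter> apollonius_circle C A B"

definition circle_inverse :: "complex \<Rightarrow> real \<Rightarrow> complex \<Rightarrow> complex" where
  "circle_inverse c r P = c + (r\<^sup>2 / (dist P c)\<^sup>2) *\<^sub>R (P - c)"

definition X15 :: "complex \<Rightarrow> complex \<Rightarrow> complex \<Rightarrow> complex" where
  "X15 A B C = (THE P. P \<in> isodynamic_points A B C \<and>
                       P \<in> ball (circumcenter A B C) (dist (circumcenter A B C) A))"

definition X16 :: "complex \<Rightarrow> complex \<Rightarrow> complex \<Rightarrow> complex" where
  "X16 A B C =
     circle_inverse (circumcenter A B C) (dist (circumcenter A B C) A) (X15 A B C)"

definition axis_ellipse :: "complex \<Rightarrow> real \<Rightarrow> real \<Rightarrow> complex set" where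
  "axis_ellipse c a b = {P. ((Re P - Re c) / a)\<^sup>2 + ((Im P - Im c) / b)\<^sup>2 = 1}"

definition ellipse_with_foci :: "complex set \<Rightarrow> complex \<Rightarrow> complex \<Rightarrow> bool" where
  "ellipse_with_foci E F G \<longleftrightarrow>
     (\<exists>s. dist F G < 2 * s \<and> E = {P. dist P F + dist P G = 2 * s})"

(* A line is tangent to an ellipse iff they have exactly one common point. *)
definition tangent_to_side :: "complex set \<Rightarrow> complex \<Rightarrow> complex \<Rightarrow> bool" where
  "tangent_to_side E A B \<longleftrightarrow> (\<exists>P \<in> closed_segment A B. E \<inter> affine hull {A, B} = {P})"

definition circumscribes :: "complex \<Rightarrow> complex \<Rightarrow> complex \<Rightarrow> complex set \<Rightarrow> bool" where
  "circumscribes A B C E \<longleftrightarrow>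
     tangent_to_side E A B \<and> tangent_to_side E B C \<and> tangent_to_side E C A"

definition is_brocard_inellipse ::
    "complex \<Rightarrow> complex \<Rightarrow> complex \<Rightarrow> complex set \<Rightarrow> bool" where
  "is_brocard_inellipse A B C E \<longleftrightarrow>
     ellipse_with_foci E (brocard_point1 A B C) (brocard_point2 A B C) \<and> circumscribes A B C E"

definition brocard_porism :: "complex set \<Rightarrow> complex set \<Rightarrow> bool" where
  "brocard_porism \<Gamma> E \<longleftrightarrow>
     (\<exists>A B C. ccw_triangle A B C \<and> \<Gamma> = circumcircle A B C \<and> is_brocard_inellipse A B C E)"

definition three_periodic ::
    "complex set \<Rightarrow> complex set \<Rightarrow> complex \<Rightarrow> complex \<Rightarrow> complex \<Rightarrow> bool" where
  "three_periodic \<Gamma> E A B C \<longleftrightarrow>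
     ccw_triangle A B C \<and> {A, B, C} \<subseteq> \<Gamma> \<and> circumscribes A B C E"

definition ell_center :: "real \<Rightarrow> complex" where
  "ell_center t = Complex 0 (- sin t)"

definition ell_a :: "real \<Rightarrow> real" where
  "ell_a t = sqrt (2 * cos t - 1) / 2"

definition ell_b :: "real \<Rightarrow> real" where
  "ell_b t = sqrt ((2 * cos t - 1) * (1 - cos t)) / sqrt 2"

definition ell :: "real \<Rightarrow> complex set" where
  "ell t = axis_ellipse (ell_center t) (ell_a t) (ell_b t)"

(* focus1 is the left focus; with counterclockwise labels it is the first Brocard point. *)

definition focus1 :: "real \<Rightarrow> complex" where
  "focus1 t = ell_center t - complex_of_real (sqrt ((ell_a t)\<^sup>2 - (ell_b t)\<^sup>2))"

definition focus2 :: "real \<Rightarrow> complex" where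
  "focus2 t = ell_center t + complex_of_real (sqrt ((ell_a t)\<^sup>2 - (ell_b t)\<^sup>2))"

(* At t = 0 the circle has no center and infinite radius (the values below are then artefacts of
   division by 0) and the ellipse is a segment; at t = pi/3 both shrink to a point. *)

definition circ_center :: "real \<Rightarrow> complex" where
  "circ_center t = Complex 0 (sin t / (2 * (cos t - 1)))"

definition circ_radius :: "real \<Rightarrow> real" where
  "circ_radius t = sqrt ((2 * cos t - 1) / (2 * (1 - cos t)))"

definition circ :: "real \<Rightarrow> complex set" where
  "circ t = sphere (circ_center t) (circ_radius t)"

end

theory Submission imports Defs
begin

text \<open>
  A Moebius map sending the two isodynamic points to 0 and \<open>\<infinity>\<close> turns the triangles with these
  isodynamic points into the equilateral triangles centered at 0, and the circles \<open>\<Gamma>\<^sub>t\<close> into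
  the circles around 0.  For points \<open>A\<close>, \<open>B\<close> of \<open>\<Gamma>\<^sub>t\<close> the chord \<open>AB\<close> touches the ellipse iff
  \<open>|A - B|\<^sup>2 = 4 R\<^sup>2 (Im A) (Im B)\<close>, and this says that the images of \<open>A\<close> and \<open>B\<close> differ by a
  rotation by \<open>\<plusminus>2 \<pi> / 3\<close>.  Hence the 3-periodics are exactly the orbits of a Moebius map of
  order 3, which proves the porism, and the Brocard angle and Brocard points can be read off
  from the three consecutive pairs of vertices.
\<close>

section \<open>Plane vectors and circumcenters\<close>

text \<open>\<open>Im (cnj u * v)\<close> is the cross product and \<open>Re (cnj u * d)\<close> the
  dot product of plane vectors: only 0 is orthogonal to two independent vectors.\<close>

lemma cross_dot_zero:
  fixes u v d :: complex
  assumes "Im (cnj u * v) \<noteq> 0" "Re (cnj u * d) = 0" "Re (cnj v * d) = 0"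
  shows "d = 0"
proof -
  have "Im (cnj u * v) * Re d = 0" "Im (cnj u * v) * Im d = 0"
    using assms(2,3) by (simp_all, algebra+)
  then show ?thesis
    using assms(1) by (simp add: complex_eq_iff)
qed

lemma cross_real_combination_zero:
  fixes u v :: complex
  assumes "Im (cnj u * v) \<noteq> 0" "of_real r * u = of_real s * v"
  shows "r = 0" "s = 0"
proof -
  have "r * Re u = s * Re v" "r * Im u = s * Im v"
    using assms(2) by (simp_all add: complex_eq_iff)
  then have "s * (Re u * Im v - Im u * Re v) = 0" "r * (Re u * Im v - Im u * Re v) = 0"
    by algebra+
  then show "r = 0" "s = 0"
    using assms(1) by auto
qed

lemma cross_zero_imp_real_multiple:
  fixes u v :: complex
  assumes "Im (cnj u * v) = 0" "u \<noteq> 0"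
  obtains s where "v = of_real s * u"
proof
  have "of_real ((cmod u)\<^sup>2) * v = cnj u * v * u"
    by (simp only: complex_norm_square mult.commute mult.left_commute)
  also have "cnj u * v = of_real (Re (cnj u * v))"
    using assms(1) by (simp only: complex_eq_iff Re_complex_of_real Im_complex_of_real simp_thms)
  finally show "v = of_real (Re (cnj u * v) / (cmod u)\<^sup>2) * u"
    using assms(2) by (simp add: field_simps del: complex_cnj_mult times_complex.sel)
qed

text \<open>Both points lie on the perpendicular bisector of \<open>A\<close> and
  \<open>B\<close>.\<close>

lemma dist_eq_imp_orthogonal:
  fixes X Y A B :: complex
  assumes "dist X A = dist X B" "dist Y A = dist Y B"
  shows "Re (cnj (B - A) * (X - Y)) = 0"
proof -
  have "(dist X A)\<^sup>2 = (dist X B)\<^sup>2" "(dist Y A)\<^sup>2 = (dist Y B)\<^sup>2"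
    using assms by simp_all
  then show ?thesis
    unfolding dist_complex_def cmod_power2 by (simp, algebra)
qed

lemma circumcenter_eqI:
  assumes "Im (cnj (B - A) * (C - A)) \<noteq> 0" "dist X A = dist X B" "dist X B = dist X C"
  shows "circumcenter A B C = X"
  unfolding circumcenter_def
proof (rule the_equality)
  fix Y assume Y: "dist Y A = dist Y B \<and> dist Y B = dist Y C"
  have "Y - X = 0"
    by (rule cross_dot_zero[OF assms(1)]; rule dist_eq_imp_orthogonal) (use Y assms in simp_all)
  then show "Y = X" by simp
qed (use assms in simp)

lemma circumcircle_eqI:
  assumes "Im (cnj (B - A) * (C - A)) \<noteq> 0" "{A, B, C} \<subseteq> sphere X r"
  shows "circumcenter A B C = X" "circumcircle A B C = sphere X r"
proof -
  show *: "circumcenter A B C = X"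
    using assms by (intro circumcenter_eqI) auto
  show "circumcircle A B C = sphere X r"
    using assms(2) unfolding circumcircle_def * by simp
qed

text \<open>A line meets a circle at most twice: inserting \<open>C = A + s * (B - A)\<close> into
  the circle equation leaves only \<open>s = 0\<close> and \<open>s = 1\<close>.\<close>

lemma cross_sphere_nonzero:
  fixes A B C X :: complex
  assumes "{A, B, C} \<subseteq> sphere X r" "A \<noteq> B" "A \<noteq> C" "B \<noteq> C"
  shows "Im (cnj (B - A) * (C - A)) \<noteq> 0"
proof
  assume 0: "Im (cnj (B - A) * (C - A)) = 0"
  obtain s where C: "C - A = of_real s * (B - A)"
    using cross_zero_imp_real_multiple[OF 0] assms(2) by auto
  have "(dist X A)\<^sup>2 = (dist X B)\<^sup>2" "(dist X A)\<^sup>2 = (dist X C)\<^sup>2"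
    using assms(1) by simp_all
  moreover have "Re C = Re A + s * (Re B - Re A)" "Im C = Im A + s * (Im B - Im A)"
    using C by (simp_all add: complex_eq_iff)
  ultimately have "s * (s - 1) * ((Re (B - A))\<^sup>2 + (Im (B - A))\<^sup>2) = 0"
    unfolding dist_complex_def cmod_power2 minus_complex.sel by algebra
  then have "s * (s - 1) * (cmod (B - A))\<^sup>2 = 0"
    unfolding cmod_power2 .
  then have "s = 0 \<or> s = 1"
    using assms(2) by simp
  then show False
    using C assms by auto
qed

lemma ccw_triangle_distinct:
  assumes "ccw_triangle A B C"
  shows "A \<noteq> B" "B \<noteq> C" "C \<noteq> A"
  using assms by (auto simp: ccw_triangle_def algebra_simps)

section \<open>Oriented angles and uniqueness of the Brocard data\<close>

lemma oangle_eqI: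
  assumes "Z - Y = of_real l * cis w * (X - Y)" "0 < l" "X \<noteq> Y" "-pi < w" "w \<le> pi"
  shows "oangle X Y Z = w"
proof -
  have "(Z - Y) / (X - Y) = rcis l w"
    using assms(1,3) by (simp add: rcis_def)
  then show ?thesis
    using assms by (simp add: oangle_def Arg_rcis)
qed

text \<open>The factor is only nonnegative because \<open>Z = Y\<close> may occur; then
  \<open>Arg 0 = 0\<close> makes the angle 0.\<close>

lemma oangle_collinear:
  assumes "oangle X Y Z = w" "X \<noteq> Y"
  obtains l where "0 \<le> l" "Z - Y = of_real l * cis w * (X - Y)"
proof
  show "0 \<le> cmod ((Z - Y) / (X - Y))" by simp
  have "(Z - Y) / (X - Y) = of_real (cmod ((Z - Y) / (X - Y))) * cis w"
    using rcis_cmod_Arg[of "(Z - Y) / (X - Y)"] assms(1) by (simp add: oangle_def rcis_def)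
  then show "Z - Y = of_real (cmod ((Z - Y) / (X - Y))) * cis w * (X - Y)"
    using assms(2) by (metis eq_iff_diff_eq_0 nonzero_divide_eq_eq)
qed


text \<open>Eliminating the point yields the classical cot w = (|AB|^2 + |BC|^2 + |CA|^2) / (4
  area), here without division; the law of cosines turns the bracket into half of that sum.\<close>

lemma brocard_point1_imp:
  assumes ccw: "ccw_triangle A B C" and P: "is_brocard_point1 A B C w P"
  shows "0 < w" "w < pi"
    and "Im (cnj (B - A) * (C - B)) * cos w
         = sin w * ((cmod (A - C))\<^sup>2 - Re (cnj (B - A) * (C - B)))"
proof -
  define a b where "a = B - A" and "b = C - B"
  define S where "S = Im (cnj a * b)"
  have S: "S > 0"
    using ccw by (simp add: S_def a_def b_def ccw_triangle_def algebra_simps)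
  have ne: "B \<noteq> A" "C \<noteq> B" "A \<noteq> C"
    using ccw_triangle_distinct[OF ccw] by auto
  from P ne obtain l m n where lmn: "0 \<le> l" "0 \<le> m" "0 \<le> n"
    "P - A = of_real l * cis w * (B - A)" "P - B = of_real m * cis w * (C - B)"
    "P - C = of_real n * cis w * (A - C)"
    unfolding is_brocard_point1_def by (metis oangle_collinear)
  \<comment> \<open>Subtracting the descriptions of \<open>P\<close> from two consecutive vertices
    eliminates \<open>P\<close>.\<close>
  have "a = of_real l * cis w * a - of_real m * cis w * b"
    "- a - b = of_real n * cis w * (- a - b) - of_real l * cis w * a"
    using lmn(4-6) unfolding a_def b_def by algebra+
  then have eqs:
    "Re a = l * (cos w * Re a - sin w * Im a) - m * (cos w * Re b - sin w * Im b)"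
    "Im a = l * (cos w * Im a + sin w * Re a) - m * (cos w * Im b + sin w * Re b)"
    "- Re a - Re b = n * (sin w * (Im a + Im b) - cos w * (Re a + Re b))
        - l * (cos w * Re a - sin w * Im a)"
    "- Im a - Im b = n * (- cos w * (Im a + Im b) - sin w * (Re a + Re b))
        - l * (cos w * Im a + sin w * Re a)"
    by (simp_all add: complex_eq_iff algebra_simps)
  have sc: "(sin w)\<^sup>2 + (cos w)\<^sup>2 = 1" by simp
  have S_eq: "S = Re a * Im b - Im a * Re b"
    by (simp add: S_def)
  \<comment> \<open>After multiplication by \<open>cis (- w)\<close> the first equation reads
    \<open>cis (- w) * a = l * a - m * b\<close>. Its cross and dot products with \<open>a\<close>
    give \<open>m\<close> and \<open>c\<close>; the cross product of the second equation with
    \<open>a + b\<close> gives \<open>l\<close>.\<close>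
  have m: "m * S = sin w * ((Re a)\<^sup>2 + (Im a)\<^sup>2)"
    using eqs(1,2) sc unfolding S_eq by algebra
  have l: "l * S = sin w * ((Re a + Re b)\<^sup>2 + (Im a + Im b)\<^sup>2)"
    using eqs(3,4) sc unfolding S_eq by algebra
  have c: "cos w * ((Re a)\<^sup>2 + (Im a)\<^sup>2)
           = l * ((Re a)\<^sup>2 + (Im a)\<^sup>2) - m * (Re a * Re b + Im a * Im b)"
    using eqs(1,2) sc by algebra
  have a0: "(Re a)\<^sup>2 + (Im a)\<^sup>2 > 0"
    using ne(1) by (simp add: a_def sum_power2_gt_zero_iff complex_eq_iff)
  have "((Re a)\<^sup>2 + (Im a)\<^sup>2) * (S * cos w
           - sin w * ((Re a + Re b)\<^sup>2 + (Im a + Im b)\<^sup>2 - (Re a * Re b + Im a * Im b))) = 0"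
    using m l c by algebra
  then have main: "S * cos w
      = sin w * ((Re a + Re b)\<^sup>2 + (Im a + Im b)\<^sup>2 - (Re a * Re b + Im a * Im b))"
    using a0 by auto
  then show "Im (cnj (B - A) * (C - B)) * cos w
      = sin w * ((cmod (A - C))\<^sup>2 - Re (cnj (B - A) * (C - B)))"
    by (simp add: S_def a_def b_def cmod_power2 power2_commute) (auto simp: algebra_simps)
  \<comment> \<open>\<open>m \<ge> 0\<close> forces \<open>sin w \<ge> 0\<close>, and
    \<open>sin w = 0\<close> would give \<open>cos w = 0\<close> by \<open>main\<close>.\<close>
  have "0 \<le> sin w * ((Re a)\<^sup>2 + (Im a)\<^sup>2)"
    using m S lmn(2) by (metis mult_nonneg_nonneg order_less_imp_le)
  then have "0 \<le> sin w"
    using a0 by (simp add: zero_le_mult_iff)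
  moreover have "sin w \<noteq> 0"
    using main S sc by (metis mult_eq_0_iff mult_zero_left order_less_irrefl power_zero_numeral
        add_0 zero_neq_one)
  ultimately have "sin w > 0" by simp
  moreover have "- pi < w" "w \<le> pi"
    using P Arg_bounded unfolding is_brocard_point1_def oangle_def by metis+
  moreover have "\<not> w < 0"
    using \<open>sin w > 0\<close> \<open>- pi < w\<close> sin_gt_zero[of "- w"] by auto
  moreover have "w \<noteq> 0" "w \<noteq> pi"
    using \<open>sin w > 0\<close> by auto
  ultimately show "0 < w" "w < pi"
    by auto
qed

text \<open>\<open>brocard_point1_imp\<close> fixes the cotangent of the angle, and the cotangent is
  injective on (0, pi).\<close>

lemma brocard_angle_unique:
  assumes "ccw_triangle A B C" "is_brocard_point1 A B C w P" "is_brocard_point1 A B C w' P'"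
  shows "w = w'"
proof -
  let ?S = "Im (cnj (B - A) * (C - B))"
  have S: "?S > 0"
    using assms(1) by (simp add: ccw_triangle_def algebra_simps)
  note w = brocard_point1_imp[OF assms(1,2)] and w' = brocard_point1_imp[OF assms(1,3)]
  have "?S * (sin w * cos w' - cos w * sin w') = 0"
    using w(3) w'(3) by algebra
  then have "sin (w - w') = 0"
    using S by (simp add: sin_diff)
  then show ?thesis
    using w(1,2) w'(1,2) sin_gt_zero[of "w - w'"] sin_gt_zero[of "w' - w"] sin_minus[of "w - w'"]
    by (cases w w' rule: linorder_cases) auto
qed

text \<open>The point is the intersection of two lines, through \<open>A\<close> and through
  \<open>B\<close>, whose directions are the independent sides turned by the same angle.\<close>

lemma brocard_point1_unique:
  assumes "ccw_triangle A B C" "is_brocard_point1 A B C w P" "is_brocard_point1 A B C w P'"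
  shows "P = P'"
proof -
  have ne: "B \<noteq> A" "C \<noteq> B"
    using ccw_triangle_distinct[OF assms(1)] by auto
  obtain l m where lm: "P - A = of_real l * cis w * (B - A)" "P - B = of_real m * cis w * (C - B)"
    using assms(2) ne unfolding is_brocard_point1_def by (metis oangle_collinear)
  obtain l' m' where lm': "P' - A = of_real l' * cis w * (B - A)" "P' - B = of_real m' * cis w * (C - B)"
    using assms(3) ne unfolding is_brocard_point1_def by (metis oangle_collinear)
  have "P - P' = of_real (l - l') * cis w * (B - A)" "P - P' = of_real (m - m') * cis w * (C - B)"
    unfolding of_real_diff using lm lm' by algebra+
  then have *: "of_real (l - l') * (B - A) = of_real (m - m') * (C - B)"
    by (simp add: mult.assoc mult.left_commute[of _ "cis w"])
  have "l - l' = 0"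
    by (rule cross_real_combination_zero(1)[OF _ *])
      (use assms(1) in \<open>auto simp: ccw_triangle_def algebra_simps\<close>)
  then have "P - A = P' - A"
    using lm lm' by simp
  then show ?thesis by simp
qed

lemma brocard_point2_unique:
  assumes "ccw_triangle A B C" "w \<noteq> 0"
    and "is_brocard_point2 A B C w P" "is_brocard_point2 A B C w P'"
  shows "P = P'"
proof -
  have lines: "\<exists>l m. Q - B = of_real l * cis (- w) * (A - B) \<and> Q - C = of_real m * cis (- w) * (B - C)"
    if Q: "is_brocard_point2 A B C w Q" for Q
  proof -
    \<comment> \<open>At \<open>Q = B\<close> or \<open>Q = C\<close> the quotient in
      \<open>oangle\<close> is a division by 0, so the angle is 0; \<open>w \<noteq> 0\<close>
      excludes this.\<close>
    have ne: "Q \<noteq> B" "Q \<noteq> C"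
      using Q assms(2) by (auto simp: is_brocard_point2_def oangle_def Arg_zero)
    then obtain l m where lm: "A - B = of_real l * cis w * (Q - B)" "B - C = of_real m * cis w * (Q - C)"
      using Q unfolding is_brocard_point2_def by (metis oangle_collinear)
    moreover have "A \<noteq> B" "B \<noteq> C"
      using ccw_triangle_distinct[OF assms(1)] by auto
    ultimately have "l \<noteq> 0" "m \<noteq> 0" by auto
    then have "Q - B = of_real (1 / l) * cis (- w) * (A - B)"
      "Q - C = of_real (1 / m) * cis (- w) * (B - C)"
      unfolding lm by (simp_all add: cis_mult mult.assoc[of _ "cis _" "cis _"] flip: cis_cnj)
        (simp_all add: field_simps cis_cnj cis_mult)
    then show ?thesis by blast
  qed
  obtain l m where lm: "P - B = of_real l * cis (- w) * (A - B)" "P - C = of_real m * cis (- w) * (B - C)"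
    using lines[OF assms(3)] by blast
  obtain l' m' where lm': "P' - B = of_real l' * cis (- w) * (A - B)"
    "P' - C = of_real m' * cis (- w) * (B - C)"
    using lines[OF assms(4)] by blast
  have "P - P' = of_real (l - l') * cis (- w) * (A - B)" "P - P' = of_real (m - m') * cis (- w) * (B - C)"
    unfolding of_real_diff using lm lm' by algebra+
  then have *: "of_real (l - l') * (A - B) = of_real (m - m') * (B - C)"
    by (simp add: mult.assoc mult.left_commute[of _ "cis (- w)"])
  have "l - l' = 0"
    by (rule cross_real_combination_zero(1)[OF _ *])
      (use assms(1) in \<open>auto simp: ccw_triangle_def algebra_simps\<close>)
  then have "P - B = P' - B"
    using lm lm' by simp
  then show ?thesis by simp
qed

lemma brocard_eqI:
  assumes "ccw_triangle A B C" "is_brocard_point1 A B C w P" "is_brocard_point2 A B C w Q"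
  shows "brocard_angle A B C = w" "brocard_point1 A B C = P" "brocard_point2 A B C = Q"
proof -
  show w: "brocard_angle A B C = w"
    unfolding brocard_angle_def
    by (rule the_equality) (use assms brocard_angle_unique in blast)+
  show "brocard_point1 A B C = P"
    unfolding brocard_point1_def w
    by (rule the_equality) (use assms brocard_point1_unique in blast)+
  have "w \<noteq> 0"
    using brocard_point1_imp(1)[OF assms(1,2)] by simp
  then show "brocard_point2 A B C = Q"
    unfolding brocard_point2_def w
    by (intro the_equality brocard_point2_unique[OF assms(1) _ _ assms(3)] assms)
qed

section \<open>Ellipses: foci and tangent lines\<close>

text \<open>On the ellipse the focal radii are a + f x / a and a - f x / a. Conversely, the
  difference of the squared radii is 4 f x, so a sum of 2 a gives back the first formula and hence
  the equation.\<close>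

lemma ellipse_with_foci_axis_ellipse:
  assumes "0 < b" "b < a"
  shows "ellipse_with_foci (axis_ellipse c a b)
    (c - of_real (sqrt (a\<^sup>2 - b\<^sup>2))) (c + of_real (sqrt (a\<^sup>2 - b\<^sup>2)))"
proof -
  define f where "f = sqrt (a\<^sup>2 - b\<^sup>2)"
  have "b\<^sup>2 < a\<^sup>2"
    using assms by (simp add: power_strict_mono)
  then have f2: "f\<^sup>2 = a\<^sup>2 - b\<^sup>2" and f0: "f > 0"
    by (simp_all add: f_def)
  have "f\<^sup>2 < a\<^sup>2"
    using assms f2 by simp
  then have fa: "f < a"
    using assms by (meson less_imp_le order_trans power_less_imp_less_base)
  have dist_foci: "dist (c - of_real f) (c + of_real f) = 2 * f"
  proof -
    have "c - of_real f - (c + of_real f) = of_real (- 2 * f)" by simp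
    then show ?thesis
      unfolding dist_complex_def using f0 by (simp del: of_real_mult of_real_minus)
  qed
  have "P \<in> axis_ellipse c a b \<longleftrightarrow> dist P (c - of_real f) + dist P (c + of_real f) = 2 * a" for P
  proof -
    define x y where "x = Re P - Re c" and "y = Im P - Im c"
    define d1 d2 where "d1 = dist P (c - of_real f)" and "d2 = dist P (c + of_real f)"
    have d: "d1\<^sup>2 = (x + f)\<^sup>2 + y\<^sup>2" "d2\<^sup>2 = (x - f)\<^sup>2 + y\<^sup>2" "0 \<le> d1" "0 \<le> d2"
      unfolding d1_def d2_def dist_complex_def cmod_power2 x_def y_def
      by (simp_all add: algebra_simps)
    have mem: "P \<in> axis_ellipse c a b \<longleftrightarrow> b\<^sup>2 * x\<^sup>2 + a\<^sup>2 * y\<^sup>2 = a\<^sup>2 * b\<^sup>2"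
      using assms by (auto simp: axis_ellipse_def x_def y_def power_divide field_simps)
    show ?thesis
      unfolding mem d1_def[symmetric] d2_def[symmetric]
    proof
      assume e: "b\<^sup>2 * x\<^sup>2 + a\<^sup>2 * y\<^sup>2 = a\<^sup>2 * b\<^sup>2"
      have "b\<^sup>2 * x\<^sup>2 \<le> b\<^sup>2 * a\<^sup>2"
        using e by (metis le_add_same_cancel1 mult.commute zero_le_mult_iff zero_le_power2)
      then have "\<bar>x\<bar> \<le> a"
        using assms by (simp add: abs_le_square_iff[symmetric])
      \<comment> \<open>Signs are needed because the focal radii are first found only up to
        squaring.\<close>
      have "\<bar>f * x\<bar> \<le> a * a"
        unfolding abs_mult using f0 fa \<open>\<bar>x\<bar> \<le> a\<close> by (intro mult_mono) auto
      then have pos: "0 \<le> a\<^sup>2 + f * x" "0 \<le> a\<^sup>2 - f * x"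
        by (auto simp: power2_eq_square)
      have "(a * d1)\<^sup>2 = (a\<^sup>2 + f * x)\<^sup>2" "(a * d2)\<^sup>2 = (a\<^sup>2 - f * x)\<^sup>2"
        using d(1,2) f2 e by algebra+
      then have "a * d1 = a\<^sup>2 + f * x" "a * d2 = a\<^sup>2 - f * x"
        using pos d(3,4) assms by (auto intro!: power2_eq_imp_eq)
      then have "a * (d1 + d2) = a * (2 * a)"
        by (simp add: algebra_simps power2_eq_square)
      then show "d1 + d2 = 2 * a"
        using assms by simp
    next
      assume s: "d1 + d2 = 2 * a"
      have "a * d1 = a\<^sup>2 + f * x"
        using d(1,2) s by algebra
      then have "(a\<^sup>2 + f * x)\<^sup>2 = a\<^sup>2 * ((x + f)\<^sup>2 + y\<^sup>2)"
        using d(1) by algebra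
      then show "b\<^sup>2 * x\<^sup>2 + a\<^sup>2 * y\<^sup>2 = a\<^sup>2 * b\<^sup>2"
        using f2 by algebra
    qed
  qed
  then have "axis_ellipse c a b = {P. dist P (c - of_real f) + dist P (c + of_real f) = 2 * a}"
    by blast
  then show ?thesis
    unfolding ellipse_with_foci_def f_def[symmetric] dist_foci using fa by auto
qed

text \<open>The points on the line satisfy a quadratic in \<open>s\<close> with leading coefficient
  \<open>m\<close> and half linear coefficient \<open>l\<close>. Multiplying by \<open>m\<close>
  completes the square, and Lagrange's identity simplifies the constant term.\<close>

lemma axis_ellipse_line:
  fixes A B c :: complex
  assumes "0 < a" "0 < b" "A \<noteq> B"
  defines "u \<equiv> B - A" and "v \<equiv> A - c"
  defines "m \<equiv> b\<^sup>2 * (Re u)\<^sup>2 + a\<^sup>2 * (Im u)\<^sup>2" and "l \<equiv> b\<^sup>2 * Re u * Re v + a\<^sup>2 * Im u * Im v"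
  shows "m > 0"
    and "A + s *\<^sub>R u \<in> axis_ellipse c a b
      \<longleftrightarrow> (m * s + l)\<^sup>2 = a\<^sup>2 * b\<^sup>2 * (m - (Re u * Im v - Im u * Re v)\<^sup>2)"
proof -
  have "u \<noteq> 0"
    using assms(3) by (simp add: u_def)
  then show m: "m > 0"
    using assms(1,2) unfolding m_def complex_eq_iff
    by (cases "Re u = 0") (auto intro: add_pos_nonneg)
  have "A + s *\<^sub>R u \<in> axis_ellipse c a b
      \<longleftrightarrow> b\<^sup>2 * (Re v + s * Re u)\<^sup>2 + a\<^sup>2 * (Im v + s * Im u)\<^sup>2 = a\<^sup>2 * b\<^sup>2"
    using assms(1,2) by (auto simp: axis_ellipse_def v_def power_divide field_simps)
  also have "\<dots> \<longleftrightarrow> m * (b\<^sup>2 * (Re v + s * Re u)\<^sup>2 + a\<^sup>2 * (Im v + s * Im u)\<^sup>2) = m * (a\<^sup>2 * b\<^sup>2)"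
    using m by simp
  also have "m * (b\<^sup>2 * (Re v + s * Re u)\<^sup>2 + a\<^sup>2 * (Im v + s * Im u)\<^sup>2)
      = (m * s + l)\<^sup>2 + a\<^sup>2 * b\<^sup>2 * (Re u * Im v - Im u * Re v)\<^sup>2"
    unfolding m_def l_def by algebra
  finally show "A + s *\<^sub>R u \<in> axis_ellipse c a b
      \<longleftrightarrow> (m * s + l)\<^sup>2 = a\<^sup>2 * b\<^sup>2 * (m - (Re u * Im v - Im u * Re v)\<^sup>2)"
    by (simp only: right_diff_distrib eq_diff_eq mult.commute[of m])
qed

lemma tangent_axis_ellipse_imp:
  fixes A B c :: complex
  assumes "0 < a" "0 < b" "A \<noteq> B" "tangent_to_side (axis_ellipse c a b) A B"
  shows "(Re (B - A) * Im (A - c) - Im (B - A) * Re (A - c))\<^sup>2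
         = b\<^sup>2 * (Re (B - A))\<^sup>2 + a\<^sup>2 * (Im (B - A))\<^sup>2"
proof -
  define m where "m = b\<^sup>2 * (Re (B - A))\<^sup>2 + a\<^sup>2 * (Im (B - A))\<^sup>2"
  define l where "l = b\<^sup>2 * Re (B - A) * Re (A - c) + a\<^sup>2 * Im (B - A) * Im (A - c)"
  define k where "k = (Re (B - A) * Im (A - c) - Im (B - A) * Re (A - c))\<^sup>2"
  note line = axis_ellipse_line(1)[OF assms(1-3), folded m_def]
    axis_ellipse_line(2)[OF assms(1-3), of _ c, folded m_def l_def k_def]
  obtain P where P: "axis_ellipse c a b \<inter> affine hull {A, B} = {P}"
    using assms(4) by (auto simp: tangent_to_side_def)
  then obtain s where s: "P = A + s *\<^sub>R (B - A)"
    by (force simp: affine_hull_2_alt)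
  have on: "(m * s + l)\<^sup>2 = a\<^sup>2 * b\<^sup>2 * (m - k)"
    using P s line(2) by auto
  \<comment> \<open>The other root of the quadratic, the mirror image of \<open>s\<close> in
    \<open>- l / m\<close>. A single common point forces both roots to agree.\<close>
  define s' where "s' = - s - 2 * l / m"
  have "m * s' + l = - (m * s + l)"
    using line(1) by (simp add: s'_def field_simps)
  then have "A + s' *\<^sub>R (B - A) \<in> axis_ellipse c a b"
    unfolding line(2) using on by (simp only: power2_minus)
  then have "A + s' *\<^sub>R (B - A) = P"
    using P by (auto simp: affine_hull_2_alt)
  then have "s' = s"
    using s assms(3) by simp
  then have "m * s + l = 0"
    using \<open>m * s' + l = - (m * s + l)\<close> by simp
  then have "m - k = 0"
    using on assms(1,2) by simp
  then show ?thesis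
    by (simp add: m_def k_def)
qed

text \<open>By the power of a point, \<open>s * (1 - s) * (cmod (B - A))\<^sup>2\<close> is
  \<open>r\<^sup>2\<close> minus the squared distance to the center, hence nonnegative.\<close>

lemma line_in_cball_imp_in_segment:
  fixes A B X :: complex
  assumes "A \<noteq> B" "A \<in> sphere X r" "B \<in> sphere X r" "A + s *\<^sub>R (B - A) \<in> cball X r"
  shows "A + s *\<^sub>R (B - A) \<in> closed_segment A B"
proof -
  have r: "(cmod (A - X))\<^sup>2 = r\<^sup>2" "(cmod (B - X))\<^sup>2 = r\<^sup>2"
    using assms(2,3) by (auto simp: dist_norm norm_minus_commute)
  have "(cmod (A + s *\<^sub>R (B - A) - X))\<^sup>2 \<le> r\<^sup>2"
    using assms(4) by (intro power_mono) (auto simp: dist_norm norm_minus_commute)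
  also have "(cmod (A + s *\<^sub>R (B - A) - X))\<^sup>2 = r\<^sup>2 - s * (1 - s) * (cmod (B - A))\<^sup>2"
    using r unfolding cmod_power2 by (simp, algebra)
  finally have "0 \<le> s * (1 - s)"
    using assms(1) by (simp add: zero_le_mult_iff)
  then have "0 \<le> s" "s \<le> 1"
    by (auto simp: zero_le_mult_iff)
  then show ?thesis
    by (auto simp: in_segment algebra_simps intro!: exI[of _ s])
qed

text \<open>A vanishing discriminant gives one common point with the line; since the ellipse lies in
  the disc, this point is on the chord itself.\<close>

lemma tangent_axis_ellipseI:
  fixes A B c :: complex
  assumes "0 < a" "0 < b" "A \<noteq> B" "A \<in> sphere X r" "B \<in> sphere X r"
    and inside: "axis_ellipse c a b \<subseteq> cball X r"
    and tangent: "(Re (B - A) * Im (A - c) - Im (B - A) * Re (A - c))\<^sup>2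
      = b\<^sup>2 * (Re (B - A))\<^sup>2 + a\<^sup>2 * (Im (B - A))\<^sup>2"
  shows "tangent_to_side (axis_ellipse c a b) A B"
proof -
  define m where "m = b\<^sup>2 * (Re (B - A))\<^sup>2 + a\<^sup>2 * (Im (B - A))\<^sup>2"
  define l where "l = b\<^sup>2 * Re (B - A) * Re (A - c) + a\<^sup>2 * Im (B - A) * Im (A - c)"
  note line = axis_ellipse_line(1)[OF assms(1-3), folded m_def]
    axis_ellipse_line(2)[OF assms(1-3), of _ c, folded m_def l_def]
  define s where "s = - l / m"
  have mem: "A + r *\<^sub>R (B - A) \<in> axis_ellipse c a b \<longleftrightarrow> r = s" for r
    using line(1) unfolding line(2) tangent m_def[symmetric]
    by (auto simp: s_def field_simps)
  have "axis_ellipse c a b \<inter> affine hull {A, B} = {A + s *\<^sub>R (B - A)}"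
    using mem by (auto simp: affine_hull_2_alt)
  moreover have "A + s *\<^sub>R (B - A) \<in> closed_segment A B"
    by (rule line_in_cball_imp_in_segment[OF assms(3-5)]) (use inside mem[of s] in blast)
  ultimately show ?thesis
    unfolding tangent_to_side_def by blast
qed


section \<open>The chord identity and the Moebius map of order 3\<close>

text \<open>The left side is a constant multiple of the discriminant of the intersection of the line
  through two points of the circle with the ellipse, the semi-axes and the center of the latter being written as rational functions of the ordinate
  \<^term>\<open>k\<close> of the circumcenter.\<close>

lemma chord_identity:
  fixes k x1 x2 y1 y2 :: real
  assumes "x1\<^sup>2 + y1\<^sup>2 + 3/4 = 2 * k * y1" "x2\<^sup>2 + y2\<^sup>2 + 3/4 = 2 * k * y2"
  defines "n \<equiv> 4 * k\<^sup>2 + 1" and "d \<equiv> (x1 - x2)\<^sup>2 + (y1 - y2)\<^sup>2"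
  shows "4 * (n * (x1 * y2 - x2 * y1) - 4 * k * (x1 - x2))\<^sup>2
           - (4 * k\<^sup>2 - 3) * (n * (y1 - y2)\<^sup>2 + 4 * (x1 - x2)\<^sup>2)
         = 4 * n * d * ((4 * k\<^sup>2 - 3) * y1 * y2 - d)"
  using assms(1,2) unfolding n_def d_def by algebra

text \<open>\<^term>\<open>mobius_step A B\<close> says that \<^term>\<open>B\<close> is the image of \<^term>\<open>A\<close> under the Moebius map
  \<open>z \<mapsto> (2 z - 3) / (4 z + 2)\<close>, which has order 3 and fixes both points \<open>\<plusminus>\<i> \<surd>3 / 2\<close>; in the
  coordinate sending these to 0 and \<open>\<infinity>\<close> it is the rotation by \<open>2 \<pi> / 3\<close>.\<close>

definition mobius_step :: "complex \<Rightarrow> complex \<Rightarrow> bool" where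
  "mobius_step A B \<longleftrightarrow> 4 * A * B + 2 * B = 2 * A - 3"

text \<open>The matrix of the map has trace 4 and determinant 16, so its cube is -64 times the
  identity. This makes the 3-periodics close up.\<close>

lemma mobius_step_cycle: "mobius_step A B \<Longrightarrow> mobius_step B C \<Longrightarrow> mobius_step C A"
  unfolding mobius_step_def by algebra

text \<open>The map and its inverse have the real poles -1/2 and 1/2, which nonreal points
  avoid.\<close>

lemma mobius_step_solve:
  assumes "mobius_step A B"
  shows "Im A \<noteq> 0 \<Longrightarrow> B = (2 * A - 3) / (4 * A + 2)" "Im B \<noteq> 0 \<Longrightarrow> A = (2 * B + 3) / (2 - 4 * B)"
proof -
  assume "Im A \<noteq> 0"
  then have "4 * A + 2 \<noteq> 0"
    by (auto simp: complex_eq_iff)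
  then show "B = (2 * A - 3) / (4 * A + 2)"
    using assms by (simp add: mobius_step_def field_simps)
next
  assume "Im B \<noteq> 0"
  then have "2 - 4 * B \<noteq> 0"
    by (auto simp: complex_eq_iff)
  then show "A = (2 * B + 3) / (2 - 4 * B)"
    using assms by (simp add: mobius_step_def field_simps)
qed

section \<open>Circle and ellipse in terms of the ordinate of the circumcenter\<close>

locale brocard_family =
  fixes t :: real
  assumes t: "0 < t" "t < pi / 3"
begin

text \<open>Equal to -cot(t/2) / 2. The ellipse's center and the squares of its semi-axes and of the
  radius are rational in it, so later identities are polynomial.\<close>

definition k :: real where
  "k = sin t / (2 * (cos t - 1))"

lemma trig_bounds: "1 / 2 < cos t" "cos t < 1" "0 < sin t"
proof -
  show "1 / 2 < cos t"
    using cos_monotone_0_pi[of t "pi / 3"] t by (simp add: cos_60)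
  show "cos t < 1"
    using cos_monotone_0_pi[of 0 t] t by simp
  show "0 < sin t"
    using t by (intro sin_gt_zero) auto
qed

lemma sin_eq: "sin t = 2 * k * (cos t - 1)"
proof -
  have "k * (2 * (cos t - 1)) = sin t"
    using trig_bounds by (subst nonzero_eq_divide_eq[symmetric]) (simp_all only: k_def, simp)
  then show ?thesis by (simp only: mult.assoc mult.left_commute)
qed

text \<open>The half-angle parametrization of the unit circle: \<open>sin_eq\<close> turns sin^2 +
  cos^2 = 1 into an equation divisible by \<open>cos t - 1\<close>.\<close>

lemma cos_k: "(4 * k\<^sup>2 + 1) * cos t = 4 * k\<^sup>2 - 1"
proof -
  have "(cos t - 1) * ((4 * k\<^sup>2 + 1) * cos t - (4 * k\<^sup>2 - 1)) = 0"
    using sin_eq sin_cos_squared_add[of t] by algebra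
  then show ?thesis
    using trig_bounds by simp
qed

lemma k_sin: "- 2 * k * sin t = cos t + 1"
  using cos_k sin_eq by algebra

lemma sin_k: "(4 * k\<^sup>2 + 1) * sin t = - 4 * k"
  using cos_k sin_eq by algebra

lemma k_bounds: "k < 0" "3 < 4 * k\<^sup>2" "k < - sqrt 3 / 2"
proof -
  show "k < 0"
    using trig_bounds by (simp add: k_def divide_pos_neg)
  have "0 < (4 * k\<^sup>2 + 1) * (2 * cos t - 1)"
    using trig_bounds by (intro mult_pos_pos) (auto intro: add_nonneg_pos)
  then show "3 < 4 * k\<^sup>2"
    using cos_k by (simp add: algebra_simps)
  then have "(sqrt 3)\<^sup>2 < (- 2 * k)\<^sup>2"
    by simp
  then have "sqrt 3 < - 2 * k"
    by (rule power_less_imp_less_base) (use \<open>k < 0\<close> in simp)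
  then show "k < - sqrt 3 / 2" by simp
qed

lemma k_sq_pos: "0 < 4 * k\<^sup>2 - 3" "0 < 4 * k\<^sup>2 + 1"
  using k_bounds by auto

lemma ell_center_k: "(4 * k\<^sup>2 + 1) * Im (ell_center t) = 4 * k" "Re (ell_center t) = 0"
  using sin_k by (simp_all add: ell_center_def)

lemma ell_a_k: "0 < ell_a t" "4 * (4 * k\<^sup>2 + 1) * (ell_a t)\<^sup>2 = 4 * k\<^sup>2 - 3"
proof -
  show "0 < ell_a t"
    using trig_bounds by (simp add: ell_a_def)
  have "(ell_a t)\<^sup>2 = (2 * cos t - 1) / 4"
    using trig_bounds by (simp add: ell_a_def power_divide)
  then show "4 * (4 * k\<^sup>2 + 1) * (ell_a t)\<^sup>2 = 4 * k\<^sup>2 - 3"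
    using cos_k by algebra
qed

lemma ell_b_k: "0 < ell_b t" "(4 * k\<^sup>2 + 1)\<^sup>2 * (ell_b t)\<^sup>2 = 4 * k\<^sup>2 - 3"
proof -
  show "0 < ell_b t"
    using trig_bounds by (simp add: ell_b_def)
  have "(ell_b t)\<^sup>2 = (2 * cos t - 1) * (1 - cos t) / 2"
    using trig_bounds by (simp add: ell_b_def power_divide)
  then show "(4 * k\<^sup>2 + 1)\<^sup>2 * (ell_b t)\<^sup>2 = 4 * k\<^sup>2 - 3"
    using cos_k by algebra
qed

lemma focal_distance: "(ell_a t)\<^sup>2 - (ell_b t)\<^sup>2 = ((2 * cos t - 1) / 2)\<^sup>2"
proof -
  have "(ell_a t)\<^sup>2 = (2 * cos t - 1) / 4" "(ell_b t)\<^sup>2 = (2 * cos t - 1) * (1 - cos t) / 2"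
    using trig_bounds by (simp_all add: ell_a_def ell_b_def power_divide)
  then show ?thesis
    by algebra
qed

lemma ell_b_less_a: "ell_b t < ell_a t"
proof -
  have "0 < (ell_a t)\<^sup>2 - (ell_b t)\<^sup>2"
    unfolding focal_distance using trig_bounds by simp
  then have "(ell_b t)\<^sup>2 < (ell_a t)\<^sup>2" by simp
  then show ?thesis
    by (rule power_less_imp_less_base) (use ell_a_k(1) in simp)
qed

text \<open>By \<open>focal_distance\<close> the linear eccentricity is
  \<open>cos t - 1 / 2\<close>. The form with \<open>cis\<close> lets the rotation by
  \<open>t / 2\<close> be split off later.\<close>

lemma focus_eq: "focus1 t = 1 / 2 - cis t" "focus2 t = cis (- t) - 1 / 2"
proof -
  have "sqrt ((ell_a t)\<^sup>2 - (ell_b t)\<^sup>2) = (2 * cos t - 1) / 2"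
    unfolding focal_distance using trig_bounds by simp
  then show "focus1 t = 1 / 2 - cis t" "focus2 t = cis (- t) - 1 / 2"
    by (simp_all add: focus1_def focus2_def ell_center_def complex_eq_iff)
qed

lemma ell_foci: "ellipse_with_foci (ell t) (focus1 t) (focus2 t)"
  unfolding ell_def focus1_def focus2_def
  using ell_b_k(1) ell_b_less_a by (rule ellipse_with_foci_axis_ellipse)

lemma circ_center_eq: "circ_center t = Complex 0 k"
  by (simp add: circ_center_def k_def)

lemma circ_radius_sq: "(circ_radius t)\<^sup>2 = k\<^sup>2 - 3 / 4" "0 < circ_radius t"
proof -
  have pos: "0 < (2 * cos t - 1) / (2 * (1 - cos t))"
    using trig_bounds by simp
  then show "0 < circ_radius t"
    by (simp add: circ_radius_def)
  have "2 * (1 - cos t) * (circ_radius t)\<^sup>2 = 2 * cos t - 1"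
    using pos trig_bounds by (simp add: circ_radius_def)
  moreover have "2 * (1 - cos t) * (k\<^sup>2 - 3 / 4) = 2 * cos t - 1"
    using cos_k by algebra
  ultimately have "2 * (1 - cos t) * (circ_radius t)\<^sup>2 = 2 * (1 - cos t) * (k\<^sup>2 - 3 / 4)"
    by simp
  then show "(circ_radius t)\<^sup>2 = k\<^sup>2 - 3 / 4"
    using trig_bounds by (simp only: mult_cancel_left) simp
qed

text \<open>The bracket is the power of \<open>z\<close> with respect to the circle. As
  \<open>k\<close> varies, these circles form a coaxal pencil whose limit points are the two
  isodynamic points.\<close>

lemma dist_circ_center: "(dist (circ_center t) z)\<^sup>2 = (circ_radius t)\<^sup>2 + ((cmod z)\<^sup>2 + 3 / 4 - 2 * k * Im z)"
  unfolding circ_center_eq dist_complex_def cmod_power2 circ_radius_sq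
  by (simp add: power2_eq_square algebra_simps)

lemma circ_iff: "z \<in> circ t \<longleftrightarrow> (cmod z)\<^sup>2 + 3 / 4 = 2 * k * Im z"
proof -
  have "z \<in> circ t \<longleftrightarrow> (dist (circ_center t) z)\<^sup>2 = (circ_radius t)\<^sup>2"
    using circ_radius_sq(2) by (auto simp: circ_def)
  then show ?thesis
    unfolding dist_circ_center by simp
qed

text \<open>Keeps all vertices below the real axis, away from the poles of the Moebius map and its
  inverse.\<close>

lemma circ_Im_neg:
  assumes "z \<in> circ t"
  shows "Im z < 0"
proof -
  have "0 < 2 * k * Im z"
    using assms unfolding circ_iff by (metis add_nonneg_pos zero_le_power2 zero_less_divide_iff
        zero_less_numeral)
  then show ?thesis
    using k_bounds(1) by (simp add: zero_less_mult_iff)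
qed

lemma ell_inside_circ: "ell t \<subseteq> cball (circ_center t) (circ_radius t)"
proof
  fix P assume "P \<in> ell t"
  then have "(ell_b t)\<^sup>2 * (Re P)\<^sup>2 + (ell_a t)\<^sup>2 * (Im P - Im (ell_center t))\<^sup>2
      = (ell_a t)\<^sup>2 * (ell_b t)\<^sup>2"
    using ell_a_k(1) ell_b_k(1)
    by (auto simp: ell_def axis_ellipse_def ell_center_k(2) power_divide field_simps)
  then have "4 * (4 * k\<^sup>2 + 1) * (4 * k\<^sup>2 + 1)\<^sup>2 *
        ((ell_b t)\<^sup>2 * (Re P)\<^sup>2 + (ell_a t)\<^sup>2 * (Im P - Im (ell_center t))\<^sup>2)
      = 4 * (4 * k\<^sup>2 + 1) * (4 * k\<^sup>2 + 1)\<^sup>2 * ((ell_a t)\<^sup>2 * (ell_b t)\<^sup>2)"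
    by simp
  \<comment> \<open>With denominators cleared, the equation of the ellipse says that the power of
    \<open>P\<close> is a nonpositive multiple of \<open>(Im P)\<^sup>2\<close>.\<close>
  then have "(4 * k\<^sup>2 - 3) * (4 * k\<^sup>2 + 1) *
      (4 * ((Re P)\<^sup>2 + (Im P)\<^sup>2 + 3 / 4 - 2 * k * Im P) + (4 * k\<^sup>2 - 3) * (Im P)\<^sup>2) = 0"
    using ell_a_k(2) ell_b_k(2) ell_center_k(1) by algebra
  then have "4 * ((cmod P)\<^sup>2 + 3 / 4 - 2 * k * Im P) = - ((4 * k\<^sup>2 - 3) * (Im P)\<^sup>2)"
    using k_sq_pos by (auto simp: cmod_power2)
  also have "\<dots> \<le> 0"
    using k_sq_pos by simp
  finally have "(dist (circ_center t) P)\<^sup>2 \<le> (circ_radius t)\<^sup>2"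
    unfolding dist_circ_center by simp
  then show "P \<in> cball (circ_center t) (circ_radius t)"
    using circ_radius_sq(2) by (auto intro: power2_le_imp_le)
qed

section \<open>Tangent chords are Moebius steps; the 3-periodics\<close>

text \<open>The tangency defect \<open>T\<close>, scaled by \<open>4 * n\<^sup>2\<close>, is the
  left side of \<open>chord_identity\<close>; of the factors on the right only the last can
  vanish.\<close>

lemma tangent_iff:
  assumes "A \<in> circ t" "B \<in> circ t" "A \<noteq> B"
  shows "tangent_to_side (ell t) A B \<longleftrightarrow> (cmod (B - A))\<^sup>2 = (4 * k\<^sup>2 - 3) * Im A * Im B"
proof -
  define n y where "n = 4 * k\<^sup>2 + 1" and "y = Im (ell_center t)"
  have n: "n > 0" "n * y = 4 * k" "4 * n * (ell_a t)\<^sup>2 = 4 * k\<^sup>2 - 3" "n\<^sup>2 * (ell_b t)\<^sup>2 = 4 * k\<^sup>2 - 3"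
    using k_sq_pos ell_center_k ell_a_k ell_b_k by (simp_all add: n_def y_def)
  define T where "T = (Re (B - A) * Im (A - ell_center t) - Im (B - A) * Re (A - ell_center t))\<^sup>2
      - ((ell_b t)\<^sup>2 * (Re (B - A))\<^sup>2 + (ell_a t)\<^sup>2 * (Im (B - A))\<^sup>2)"
  have "tangent_to_side (ell t) A B \<longleftrightarrow> T = 0"
    using tangent_axis_ellipse_imp[of "ell_a t" "ell_b t" A B "ell_center t"]
      tangent_axis_ellipseI[of "ell_a t" "ell_b t" A B "circ_center t" "circ_radius t" "ell_center t"]
      assms ell_a_k(1) ell_b_k(1) ell_inside_circ
    by (auto simp: T_def ell_def circ_def)
  also have "\<dots> \<longleftrightarrow> 4 * n\<^sup>2 * T = 0"
    using n(1) by simp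
  also have "4 * n\<^sup>2 * T = 4 * (n * (Re A * Im B - Re B * Im A) - 4 * k * (Re A - Re B))\<^sup>2
      - (4 * k\<^sup>2 - 3) * (n * (Im A - Im B)\<^sup>2 + 4 * (Re A - Re B)\<^sup>2)"
    unfolding T_def minus_complex.sel ell_center_k(2) y_def[symmetric] using n(2-4) by algebra
  also have "\<dots> = 4 * n * (cmod (B - A))\<^sup>2 * ((4 * k\<^sup>2 - 3) * Im A * Im B - (cmod (B - A))\<^sup>2)"
    using chord_identity[of "Re A" "Im A" k "Re B" "Im B"] assms(1,2)
    unfolding circ_iff n_def cmod_power2 by (simp add: power2_commute)
  also have "\<dots> = 0 \<longleftrightarrow> (cmod (B - A))\<^sup>2 = (4 * k\<^sup>2 - 3) * Im A * Im B"
    using n(1) assms(3) by auto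
  finally show ?thesis .
qed

text \<open>The circle equation in \<open>z\<close> and \<open>cnj z\<close>, used to eliminate
  conjugates.\<close>

lemma circ_cnj:
  assumes "z \<in> circ t"
  shows "z * cnj z + 3 / 4 = - (\<i> * of_real k) * (z - cnj z)"
proof -
  have "(Re z)\<^sup>2 + (Im z)\<^sup>2 + 3 / 4 = 2 * k * Im z"
    using assms unfolding circ_iff cmod_power2 .
  then show ?thesis
    by (simp add: complex_eq_iff power2_eq_square)
qed

lemma chord_complex: "(\<i> * of_real k)\<^sup>2 + 3 / 4 \<noteq> (0 :: complex)"
  "(cmod (B - A))\<^sup>2 = (4 * k\<^sup>2 - 3) * Im A * Im B \<longleftrightarrow>
    (B - A) * (cnj B - cnj A) = ((\<i> * of_real k)\<^sup>2 + 3 / 4) * (A - cnj A) * (B - cnj B)"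
proof -
  have k: "(\<i> * of_real k)\<^sup>2 + 3 / 4 = (of_real (3 / 4 - k\<^sup>2) :: complex)"
    by (simp add: power_mult_distrib)
  show "(\<i> * of_real k)\<^sup>2 + 3 / 4 \<noteq> (0 :: complex)"
    unfolding k of_real_eq_0_iff using k_bounds by simp
  have "(B - A) * (cnj B - cnj A) = of_real ((cmod (B - A))\<^sup>2)"
    by (simp only: complex_norm_square complex_cnj_diff)
  moreover have "of_real (3 / 4 - k\<^sup>2) * (A - cnj A) * (B - cnj B)
      = of_real ((4 * k\<^sup>2 - 3) * Im A * Im B)"
    by (simp add: complex_eq_iff algebra_simps)
  ultimately show "(cmod (B - A))\<^sup>2 = (4 * k\<^sup>2 - 3) * Im A * Im B \<longleftrightarrow>
    (B - A) * (cnj B - cnj A) = ((\<i> * of_real k)\<^sup>2 + 3 / 4) * (A - cnj A) * (B - cnj B)"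
    unfolding k by (simp only: of_real_eq_iff)
qed

text \<open>Eliminating conjugates leaves
  \<open>(B - A)\<^sup>2 = (A\<^sup>2 + 3 / 4) * (B\<^sup>2 + 3 / 4)\<close>. The parameter
  \<open>k\<close> has dropped out, and the difference of the sides splits into the equations of the
  two steps.\<close>

lemma chord_iff_mobius_step:
  assumes "A \<in> circ t" "B \<in> circ t"
  shows "(cmod (B - A))\<^sup>2 = (4 * k\<^sup>2 - 3) * Im A * Im B \<longleftrightarrow> mobius_step A B \<or> mobius_step B A"
proof -
  define K where "K = \<i> * of_real k"
  note A = circ_cnj[OF assms(1), folded K_def] and B = circ_cnj[OF assms(2), folded K_def]
  have K0: "K\<^sup>2 + 3 / 4 \<noteq> 0"
    unfolding K_def by (rule chord_complex)
  have conj: "(A - cnj A) * (A - K) = A\<^sup>2 + 3 / 4" "(B - cnj B) * (B - K) = B\<^sup>2 + 3 / 4"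
    "(cnj B - cnj A) * (A - K) * (B - K) = (B - A) * (K\<^sup>2 + 3 / 4)"
    using A B by algebra+
  have "circ_center t = K"
    by (simp add: circ_center_eq K_def complex_eq_iff)
  then have AK: "A - K \<noteq> 0" "B - K \<noteq> 0"
    using circ_radius_sq(2) assms by (auto simp: circ_def)
  \<comment> \<open>Multiplying by \<open>(A - K) * (B - K)\<close> makes \<open>conj\<close>
    applicable; the factors are nonzero since \<open>K\<close> is the center.\<close>
  have "(cmod (B - A))\<^sup>2 = (4 * k\<^sup>2 - 3) * Im A * Im B
      \<longleftrightarrow> (A - K) * (B - K) * ((B - A) * (cnj B - cnj A))
        = (A - K) * (B - K) * ((K\<^sup>2 + 3 / 4) * (A - cnj A) * (B - cnj B))"
    unfolding chord_complex(2) K_def[symmetric] using AK by simp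
  also have "(A - K) * (B - K) * ((B - A) * (cnj B - cnj A)) = (K\<^sup>2 + 3 / 4) * (B - A)\<^sup>2"
    using conj(3) by algebra
  also have "(A - K) * (B - K) * ((K\<^sup>2 + 3 / 4) * (A - cnj A) * (B - cnj B))
      = (K\<^sup>2 + 3 / 4) * ((A\<^sup>2 + 3 / 4) * (B\<^sup>2 + 3 / 4))"
    using conj(1,2) by algebra
  also have "(K\<^sup>2 + 3 / 4) * (B - A)\<^sup>2 = (K\<^sup>2 + 3 / 4) * ((A\<^sup>2 + 3 / 4) * (B\<^sup>2 + 3 / 4))
      \<longleftrightarrow> 16 * ((B - A)\<^sup>2 - (A\<^sup>2 + 3 / 4) * (B\<^sup>2 + 3 / 4)) = 0"
    using K0 by simp
  also have "16 * ((B - A)\<^sup>2 - (A\<^sup>2 + 3 / 4) * (B\<^sup>2 + 3 / 4))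
      = (4 * A * B + 2 * B - (2 * A - 3)) * ((2 * B - 3) - (4 * B * A + 2 * A))"
    by (simp add: field_simps power2_eq_square)
  finally show ?thesis
    by (auto simp: mobius_step_def)
qed

text \<open>Having real coefficients, the map commutes with conjugation; up to the factor
  \<open>16 / (cmod (4 * A + 2))\<^sup>2\<close> it preserves the form in
  \<open>circ_cnj\<close>.\<close>

lemma mobius_step_mem_circ:
  assumes "A \<in> circ t" "mobius_step A B"
  shows "B \<in> circ t"
proof -
  define K where "K = \<i> * of_real k"
  note A = circ_cnj[OF assms(1), folded K_def]
  have s1: "(4 * A + 2) * B = 2 * A - 3"
    using assms(2) unfolding mobius_step_def by algebra
  have s2: "(4 * cnj A + 2) * cnj B = 2 * cnj A - 3"
    using arg_cong[OF s1, of cnj] by simp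
  have ne: "4 * A + 2 \<noteq> 0" "4 * cnj A + 2 \<noteq> 0"
    using circ_Im_neg[OF assms(1)] by (auto simp: complex_eq_iff)
  have "(4 * A + 2) * (4 * cnj A + 2) * (B * cnj B + 3 / 4 + K * (B - cnj B))
      = 16 * (A * cnj A + 3 / 4 + K * (A - cnj A))"
    using s1 s2 by algebra
  also have "\<dots> = 0"
    using A by simp
  finally have "B * cnj B + 3 / 4 + K * (B - cnj B) = 0"
    using ne by simp
  then have "Re (B * cnj B + 3 / 4 + K * (B - cnj B)) = 0"
    by simp
  then show ?thesis
    unfolding circ_iff cmod_power2 by (simp add: K_def power2_eq_square)
qed

lemma mobius_step_chord:
  assumes "A \<in> circ t" "mobius_step A B"
  shows "(cmod (B - A))\<^sup>2 = (4 * k\<^sup>2 - 3) * Im A * Im B" "A \<noteq> B"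
proof -
  have B: "B \<in> circ t"
    using mobius_step_mem_circ assms by blast
  then show *: "(cmod (B - A))\<^sup>2 = (4 * k\<^sup>2 - 3) * Im A * Im B"
    using chord_iff_mobius_step assms by blast
  have "0 < (4 * k\<^sup>2 - 3) * Im A * Im B"
    using circ_Im_neg[OF assms(1)] circ_Im_neg[OF B] k_sq_pos
    by (simp add: mult.assoc mult_neg_neg)
  then show "A \<noteq> B"
    using * by auto
qed

lemma ex_mobius_step:
  assumes "A \<in> circ t"
  obtains B where "mobius_step A B"
proof
  have "4 * A + 2 \<noteq> 0"
    using circ_Im_neg[OF assms] by (auto simp: complex_eq_iff)
  then have "(4 * A + 2) * ((2 * A - 3) / (4 * A + 2)) = 2 * A - 3"
    by simp
  then show "mobius_step A ((2 * A - 3) / (4 * A + 2))"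
    unfolding mobius_step_def by algebra
qed

text \<open>Both \<open>B - A\<close> and \<open>C - A\<close> are quotients of
  \<open>4 * A\<^sup>2 + 3\<close> up to sign, so (C - A) / (B - A) = -p / q. Its imaginary part has
  the sign of \<open>- Im A\<close>.\<close>

lemma mobius_step_ccw:
  assumes "A \<in> circ t" "mobius_step A B" "mobius_step B C"
  shows "ccw_triangle A B C"
proof -
  have "mobius_step C A"
    using mobius_step_cycle assms by blast
  define p q where "p = 4 * A + 2" and "q = 2 - 4 * A"
  have ne: "p \<noteq> 0" "q \<noteq> 0"
    using circ_Im_neg[OF assms(1)] by (auto simp: p_def q_def complex_eq_iff)
  have "B - A \<noteq> 0"
    using mobius_step_chord(2)[OF assms(1,2)] by simp
  have BA: "p * (B - A) = - (4 * A\<^sup>2 + 3)"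
    using assms(2) unfolding p_def mobius_step_def by algebra
  have CA: "q * (C - A) = 4 * A\<^sup>2 + 3"
    using \<open>mobius_step C A\<close> unfolding q_def mobius_step_def by algebra
  have "q * (cnj (B - A) * (C - A)) = - (p * (cnj (B - A) * (B - A)))"
    using BA CA by algebra
  also have "cnj (B - A) * (B - A) = of_real ((cmod (B - A))\<^sup>2)"
    by (simp only: complex_norm_square mult.commute)
  finally have "of_real ((cmod q)\<^sup>2) * (cnj (B - A) * (C - A))
      = - of_real ((cmod (B - A))\<^sup>2) * (p * cnj q)"
    unfolding complex_norm_square[of q] by algebra
  then have "Im (of_real ((cmod q)\<^sup>2) * (cnj (B - A) * (C - A)))
      = Im (- of_real ((cmod (B - A))\<^sup>2) * (p * cnj q))"
    by (rule arg_cong)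
  moreover have "Im (p * cnj q) = 16 * Im A"
    by (simp add: p_def q_def algebra_simps)
  ultimately have "(cmod q)\<^sup>2 * Im (cnj (B - A) * (C - A)) = - (cmod (B - A))\<^sup>2 * (16 * Im A)"
    by (simp only: Im_complex_of_real Re_complex_of_real times_complex.sel uminus_complex.sel)
  also have "\<dots> > 0"
    using circ_Im_neg[OF assms(1)] \<open>B - A \<noteq> 0\<close> by (simp add: mult_pos_neg)
  finally show ?thesis
    unfolding ccw_triangle_def by (simp add: zero_less_mult_iff)
qed

lemma mobius_step_inj:
  assumes "A \<in> circ t"
  shows "mobius_step A B \<Longrightarrow> mobius_step A C \<Longrightarrow> B = C" "mobius_step B A \<Longrightarrow> mobius_step C A \<Longrightarrow> B = C"
  using mobius_step_solve circ_Im_neg[OF assms] by (metis less_irrefl)+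

text \<open>Every tangent side is a step in one of its two directions. If the directions do not form
  a cycle, some vertex has two successors, against injectivity; the reversed cycle has the wrong
  orientation.\<close>

lemma three_periodic_iff:
  "three_periodic (circ t) (ell t) A B C \<longleftrightarrow> A \<in> circ t \<and> mobius_step A B \<and> mobius_step B C"
proof
  assume T: "three_periodic (circ t) (ell t) A B C"
  then have ccw: "ccw_triangle A B C" and mem: "A \<in> circ t" "B \<in> circ t" "C \<in> circ t"
    and tan: "tangent_to_side (ell t) A B" "tangent_to_side (ell t) B C" "tangent_to_side (ell t) C A"
    by (auto simp: three_periodic_def circumscribes_def)
  note ne = ccw_triangle_distinct[OF ccw]
  have st: "mobius_step A B \<or> mobius_step B A" "mobius_step B C \<or> mobius_step C B"
    "mobius_step C A \<or> mobius_step A C"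
    using tan mem ne by (auto simp: tangent_iff chord_iff_mobius_step)
  have "\<not> (mobius_step A C \<and> mobius_step C B)"
  proof
    assume "mobius_step A C \<and> mobius_step C B"
    then have "ccw_triangle A C B"
      using mobius_step_ccw mem by blast
    then show False
      using ccw by (simp add: ccw_triangle_def algebra_simps)
  qed
  then show "A \<in> circ t \<and> mobius_step A B \<and> mobius_step B C"
    using st mem ne mobius_step_inj mobius_step_cycle by metis
next
  assume *: "A \<in> circ t \<and> mobius_step A B \<and> mobius_step B C"
  then have st: "mobius_step A B" "mobius_step B C" "mobius_step C A" and mem: "A \<in> circ t" "B \<in> circ t" "C \<in> circ t"
    using mobius_step_mem_circ mobius_step_cycle by blast+
  show "three_periodic (circ t) (ell t) A B C"
    unfolding three_periodic_def circumscribes_def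
    using * st mem mobius_step_ccw mobius_step_chord by (simp add: tangent_iff)
qed

section \<open>Brocard angle and Brocard points\<close>

lemma cis_half:
  "cis t = cis (t / 2) * cis (t / 2)"
  "2 * \<i> * of_real (sin (t / 2)) * cis (t / 2) = cis t - 1"
proof -
  show 1: "cis t = cis (t / 2) * cis (t / 2)"
    by (simp add: cis_mult)
  have "(sin (t / 2))\<^sup>2 + (cos (t / 2))\<^sup>2 = 1" by simp
  then show "2 * \<i> * of_real (sin (t / 2)) * cis (t / 2) = cis t - 1"
    unfolding 1 by (simp add: complex_eq_iff power2_eq_square)
qed

lemma sin_half_pos: "0 < sin (t / 2)"
  using t by (intro sin_gt_zero) auto

text \<open>The complex half-angle formula for the circumcenter, used to eliminate \<open>k\<close>
  in favour of \<open>cis t\<close>.\<close>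

lemma center_cis: "2 * (\<i> * of_real k) * (cis t - 1) = cis t + 1"
proof (rule complex_eqI)
  show "Re (2 * (\<i> * of_real k) * (cis t - 1)) = Re (cis t + 1)"
    using k_sin by simp
  show "Im (2 * (\<i> * of_real k) * (cis t - 1)) = Im (cis t + 1)"
    using sin_eq by simp
qed

text \<open>Isolates \<open>cis t - 1\<close>, which is independent of the vertex and by
  \<open>cis_half\<close> carries the rotation by \<open>t / 2\<close>.\<close>

lemma focus1_diff:
  assumes "z \<in> circ t"
  shows "focus1 t - z = (cis t - 1) * (1 / 2 + cnj z) * (z - \<i> * of_real k)"
  using circ_cnj[OF assms] center_cis unfolding focus_eq by algebra

text \<open>The factor \<open>cis t\<close> on the left clears the \<open>cis (- t)\<close> in the
  second focus.\<close>

lemma focus2_diff: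
  assumes "z \<in> circ t"
  shows "cis t * (focus2 t - z) = (1 - cis t) * (1 / 2 - cnj z) * (z - \<i> * of_real k)"
proof -
  have "cis t * cis (- t) = 1"
    by (simp add: cis_mult)
  then show ?thesis
    using circ_cnj[OF assms] center_cis unfolding focus_eq by algebra
qed

lemma circ_factor:
  assumes "z \<in> circ t"
  shows "z\<^sup>2 + 3 / 4 = 2 * \<i> * of_real (Im z) * (z - \<i> * of_real k)"
proof -
  have "2 * \<i> * of_real (Im z) = z - cnj z"
    by (simp add: complex_eq_iff)
  then show ?thesis
    using circ_cnj[OF assms] by algebra
qed

text \<open>By \<open>circ_factor\<close> and the step equation, B - A = -2 \<i> Im A (A - \<i> k) /
  p. Dividing \<open>focus1_diff\<close> by this cancels \<open>A - \<i> * of_real k\<close> and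
  leaves \<open>l * cis (t / 2)\<close> with \<open>l > 0\<close>.\<close>

lemma oangle_focus1:
  assumes "A \<in> circ t" "mobius_step A B"
  shows "oangle B A (focus1 t) = t / 2"
proof (rule oangle_eqI)
  define p l where "p = 1 / 2 + A" and "l = - sin (t / 2) * (cmod p)\<^sup>2 / Im A"
  have y: "Im A < 0"
    using circ_Im_neg assms by blast
  then have p: "p \<noteq> 0"
    by (auto simp: p_def complex_eq_iff)
  show "0 < l"
    using y p sin_half_pos by (simp add: l_def divide_less_0_iff)
  show "B \<noteq> A"
    using mobius_step_chord assms by blast
  have "of_real (Im A * l) = - of_real (sin (t / 2)) * (p * cnj p)"
    using y unfolding l_def complex_norm_square[symmetric] by simp
  moreover have "p * (B - A) = - (A\<^sup>2 + 3 / 4)"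
    using assms(2) unfolding p_def mobius_step_def by algebra
  moreover have "focus1 t - A = 2 * \<i> * of_real (sin (t / 2)) * cis (t / 2) * cnj p * (A - \<i> * of_real k)"
    unfolding cis_half(2) p_def using focus1_diff[OF assms(1)] by simp
  ultimately have "of_real (Im A) * p * (focus1 t - A)
      = of_real (Im A) * p * (of_real l * cis (t / 2) * (B - A))"
    using circ_factor[OF assms(1)] unfolding of_real_mult by algebra
  then show "focus1 t - A = of_real l * cis (t / 2) * (B - A)"
    using y p by simp
qed (use t in auto)

text \<open>The mirror computation at \<open>B\<close>, with the inverse step: now \<open>p\<close>
  comes from the pole 1/2 and \<open>p * (A - B) = B\<^sup>2 + 3 / 4\<close>.\<close>

lemma oangle_focus2:
  assumes "B \<in> circ t" "mobius_step A B"
  shows "oangle (focus2 t) B A = t / 2"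
proof (rule oangle_eqI)
  define p l where "p = 1 / 2 - B" and "l = - Im B / (sin (t / 2) * (cmod p)\<^sup>2)"
  have y: "Im B < 0"
    using circ_Im_neg assms by blast
  then have p: "p \<noteq> 0"
    by (auto simp: p_def complex_eq_iff)
  show "0 < l"
    using y p sin_half_pos by (simp add: l_def divide_less_0_iff)
  have AB: "p * (A - B) = B\<^sup>2 + 3 / 4"
    using assms(2) unfolding p_def mobius_step_def by algebra
  have "l * (sin (t / 2) * (cmod p)\<^sup>2) = - Im B"
    using p sin_half_pos by (simp add: l_def)
  then have "of_real (l * (sin (t / 2) * (cmod p)\<^sup>2)) = (of_real (- Im B) :: complex)"
    by (rule arg_cong)
  then have "of_real l * of_real (sin (t / 2)) * (p * cnj p) = - of_real (Im B)"
    unfolding complex_norm_square[symmetric] by (simp add: mult.assoc)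
  moreover have "cis t * (focus2 t - B)
      = - 2 * \<i> * of_real (sin (t / 2)) * cis (t / 2) * cnj p * (B - \<i> * of_real k)"
  proof -
    have "- 2 * \<i> * of_real (sin (t / 2)) * cis (t / 2) = 1 - cis t"
      using cis_half(2) by simp
    moreover have "cnj p = 1 / 2 - cnj B"
      by (simp add: p_def)
    ultimately show ?thesis
      using focus2_diff[OF assms(1)] by simp
  qed
  ultimately have "p * of_real l * cis (t / 2) * (cis t * (focus2 t - B))
      = 2 * \<i> * of_real (Im B) * (cis (t / 2) * cis (t / 2)) * (B - \<i> * of_real k)"
    by algebra
  also have "\<dots> = cis t * (B\<^sup>2 + 3 / 4)"
    unfolding circ_factor[OF assms(1)] cis_half(1) by (simp only: mult_ac)
  also have "\<dots> = cis t * p * (A - B)"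
    using AB by (simp only: mult.assoc)
  finally have "cis t * p * (A - B) = cis t * p * (of_real l * cis (t / 2) * (focus2 t - B))"
    by (simp only: mult_ac)
  then show "A - B = of_real l * cis (t / 2) * (focus2 t - B)"
    using p by simp
  have "A \<noteq> B"
    using mobius_step_chord(2)[OF assms(1)] assms(2) by blast
  then show "focus2 t \<noteq> B"
    using \<open>A - B = of_real l * cis (t / 2) * (focus2 t - B)\<close> by auto
qed (use t in auto)

section \<open>Isodynamic points and the assembled triangle data\<close>

text \<open>By \<open>mobius_step_chord\<close> the squared sides at \<open>A\<close> are
  proportional to \<open>Im B\<close> and \<open>Im C\<close>.\<close>

lemma mem_apollonius_iff:
  assumes "A \<in> circ t" "mobius_step A B" "mobius_step B C"
  shows "P \<in> apollonius_circle A B C \<longleftrightarrow> (dist P B)\<^sup>2 * Im C = (dist P C)\<^sup>2 * Im B"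
proof -
  have mem: "B \<in> circ t" "C \<in> circ t" and st: "mobius_step C A"
    using assms mobius_step_mem_circ mobius_step_cycle by blast+
  have AC: "(dist A C)\<^sup>2 = (4 * k\<^sup>2 - 3) * Im A * Im C"
    using mobius_step_chord(1)[OF mem(2) st] by (simp add: dist_norm mult_ac)
  have AB: "(dist A B)\<^sup>2 = (4 * k\<^sup>2 - 3) * Im A * Im B"
    using mobius_step_chord(1)[OF assms(1,2)] by (simp add: dist_norm norm_minus_commute)
  have "P \<in> apollonius_circle A B C \<longleftrightarrow> (dist P B * dist A C)\<^sup>2 = (dist P C * dist A B)\<^sup>2"
    by (simp add: apollonius_circle_def)
  also have "\<dots> \<longleftrightarrow> (4 * k\<^sup>2 - 3) * Im A * ((dist P B)\<^sup>2 * Im C)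
      = (4 * k\<^sup>2 - 3) * Im A * ((dist P C)\<^sup>2 * Im B)"
    unfolding power_mult_distrib AC AB by (simp only: mult_ac)
  also have "\<dots> \<longleftrightarrow> (dist P B)\<^sup>2 * Im C = (dist P C)\<^sup>2 * Im B"
    using k_sq_pos circ_Im_neg[OF assms(1)] by simp
  finally show ?thesis .
qed

text \<open>The circle equation removes the quadratic terms in \<open>z\<close>, leaving an affine
  function of \<open>z\<close>.\<close>

lemma dist_sq_circ:
  assumes "z \<in> circ t"
  shows "(dist P z)\<^sup>2 = (cmod P)\<^sup>2 - 3 / 4 - 2 * Re P * Re z + (2 * k - 2 * Im P) * Im z"
  using assms unfolding circ_iff dist_complex_def cmod_power2 minus_complex.sel by algebra

lemma isodynamic_points_eq:
  assumes "A \<in> circ t" "mobius_step A B" "mobius_step B C"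
  shows "isodynamic_points A B C = {Complex 0 (- sqrt 3 / 2), Complex 0 (sqrt 3 / 2)}"
proof -
  have mem: "A \<in> circ t" "B \<in> circ t" "C \<in> circ t"
    and st: "mobius_step A B" "mobius_step B C" "mobius_step C A"
    using assms mobius_step_mem_circ mobius_step_cycle by blast+
  note neg = mem[THEN circ_Im_neg]
  have iso: "P \<in> isodynamic_points A B C \<longleftrightarrow> (dist P B)\<^sup>2 * Im C = (dist P C)\<^sup>2 * Im B
      \<and> (dist P C)\<^sup>2 * Im A = (dist P A)\<^sup>2 * Im C \<and> (dist P A)\<^sup>2 * Im B = (dist P B)\<^sup>2 * Im A" for P
    using mem st by (simp add: isodynamic_points_def mem_apollonius_iff)
  have pts: "P \<in> {Complex 0 (- sqrt 3 / 2), Complex 0 (sqrt 3 / 2)} \<longleftrightarrow> Re P = 0 \<and> (cmod P)\<^sup>2 = 3 / 4" for P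
  proof -
    have "(Im P)\<^sup>2 = 3 / 4 \<longleftrightarrow> (Im P)\<^sup>2 = (sqrt 3 / 2)\<^sup>2"
      by (simp add: power_divide)
    also have "\<dots> \<longleftrightarrow> Im P = sqrt 3 / 2 \<or> Im P = - (sqrt 3 / 2)"
      by (rule power2_eq_iff)
    finally show ?thesis
      by (auto simp: complex_eq_iff cmod_power2)
  qed
  have "P \<in> isodynamic_points A B C \<longleftrightarrow> Re P = 0 \<and> (cmod P)\<^sup>2 = 3 / 4" for P
  proof
    assume P: "P \<in> isodynamic_points A B C"
    \<comment> \<open>At an isodynamic point the ratio of squared distance to ordinate is the same
      for all three vertices.\<close>
    define m where "m = (dist P A)\<^sup>2 / Im A"
    have m: "(dist P A)\<^sup>2 = m * Im A" "(dist P B)\<^sup>2 = m * Im B" "(dist P C)\<^sup>2 = m * Im C"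
      using P neg unfolding iso m_def by (auto simp: field_simps)
    \<comment> \<open>The gradient of an affine function of \<open>z\<close> that vanishes at three
      noncollinear vertices; so it is 0, and the constant term vanishes too.\<close>
    define d where "d = Complex (- 2 * Re P) (2 * k - 2 * Im P - m)"
    have d: "(cmod P)\<^sup>2 - 3 / 4 + Re d * Re z + Im d * Im z = 0" if "z \<in> {A, B, C}" for z
      using m that mem dist_sq_circ[of z P] by (auto simp: d_def algebra_simps)
    have "d = 0"
    proof (rule cross_dot_zero)
      show "Im (cnj (B - A) * (C - A)) \<noteq> 0"
        using mobius_step_ccw[OF assms] by (simp add: ccw_triangle_def)
      show "Re (cnj (B - A) * d) = 0" "Re (cnj (C - A) * d) = 0"
        using d[of A] d[of B] d[of C] by (auto simp: algebra_simps)
    qed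
    then show "Re P = 0 \<and> (cmod P)\<^sup>2 = 3 / 4"
      using d[of A] by (simp add: d_def complex_eq_iff)
  next
    assume P: "Re P = 0 \<and> (cmod P)\<^sup>2 = 3 / 4"
    have "(dist P z)\<^sup>2 = (2 * k - 2 * Im P) * Im z" if "z \<in> circ t" for z
      unfolding dist_sq_circ[OF that] P[THEN conjunct1] P[THEN conjunct2] by simp
    then show "P \<in> isodynamic_points A B C"
      unfolding iso using mem by simp
  qed
  then show ?thesis
    using pts by blast
qed

lemma circumcircle_eq:
  assumes "A \<in> circ t" "mobius_step A B" "mobius_step B C"
  shows "circumcenter A B C = circ_center t" "circumcircle A B C = circ t"
proof -
  have "Im (cnj (B - A) * (C - A)) \<noteq> 0"
    using mobius_step_ccw[OF assms] by (simp add: ccw_triangle_def)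
  moreover have "{A, B, C} \<subseteq> sphere (circ_center t) (circ_radius t)"
    using assms mobius_step_mem_circ unfolding circ_def[symmetric] by blast
  ultimately show "circumcenter A B C = circ_center t" "circumcircle A B C = circ t"
    unfolding circ_def by (rule circumcircle_eqI)+
qed

text \<open>The powers of the two points are 3/2 + k sqrt 3 and 3/2 - k sqrt 3; their signs follow
  from \<open>k_bounds\<close>.\<close>

lemma isodynamic_inside:
  "dist (circ_center t) (Complex 0 (- sqrt 3 / 2)) < circ_radius t"
  "circ_radius t < dist (circ_center t) (Complex 0 (sqrt 3 / 2))"
proof -
  have "(dist (circ_center t) (Complex 0 (- sqrt 3 / 2)))\<^sup>2 < (circ_radius t)\<^sup>2"
    "(circ_radius t)\<^sup>2 < (dist (circ_center t) (Complex 0 (sqrt 3 / 2)))\<^sup>2"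
    unfolding dist_circ_center using k_bounds(3)
      mult_strict_right_mono[OF k_bounds(3), of "sqrt 3"] mult_neg_pos[OF k_bounds(1), of "sqrt 3"]
    by (simp_all add: cmod_power2 power_divide)
  then show "dist (circ_center t) (Complex 0 (- sqrt 3 / 2)) < circ_radius t"
    "circ_radius t < dist (circ_center t) (Complex 0 (sqrt 3 / 2))"
    using circ_radius_sq(2) by (auto intro: power_less_imp_less_base)
qed

text \<open>The squared radius \<open>k\<^sup>2 - 3 / 4\<close> is the product of the two points'
  distances from the center.\<close>

lemma circle_inverse_isodynamic:
  "circle_inverse (circ_center t) (circ_radius t) (Complex 0 (- sqrt 3 / 2)) = Complex 0 (sqrt 3 / 2)"
proof -
  have d: "dist (Complex 0 (- sqrt 3 / 2)) (circ_center t) = - sqrt 3 / 2 - k"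
    using k_bounds(3) by (simp add: circ_center_eq dist_complex_def cmod_def)
  have "(k\<^sup>2 - 3 / 4) / (- sqrt 3 / 2 - k)\<^sup>2 * (- sqrt 3 / 2 - k) = sqrt 3 / 2 - k"
  proof -
    have "- sqrt 3 / 2 - k \<noteq> 0"
      using k_bounds(3) by simp
    moreover have "k\<^sup>2 - 3 / 4 = (sqrt 3 / 2 - k) * (- sqrt 3 / 2 - k)"
      by (simp add: algebra_simps power2_eq_square)
    ultimately show ?thesis
      by (simp add: power2_eq_square)
  qed
  then show ?thesis
    unfolding circle_inverse_def d circ_radius_sq(1)
    by (simp add: circ_center_eq complex_eq_iff)
qed

lemma X15_X16_eq:
  assumes "A \<in> circ t" "mobius_step A B" "mobius_step B C"
  shows "X15 A B C = Complex 0 (- sqrt 3 / 2)" "X16 A B C = Complex 0 (sqrt 3 / 2)"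
proof -
  have r: "dist (circ_center t) A = circ_radius t"
    using assms(1) by (simp add: circ_def)
  show X15: "X15 A B C = Complex 0 (- sqrt 3 / 2)"
    unfolding X15_def isodynamic_points_eq[OF assms] circumcircle_eq[OF assms] r
    by (rule the_equality) (use isodynamic_inside in auto)
  show "X16 A B C = Complex 0 (sqrt 3 / 2)"
    unfolding X16_def X15 circumcircle_eq[OF assms] r by (rule circle_inverse_isodynamic)
qed

lemma brocard_eq:
  assumes "A \<in> circ t" "mobius_step A B" "mobius_step B C"
  shows "brocard_angle A B C = t / 2" "brocard_point1 A B C = focus1 t"
    "brocard_point2 A B C = focus2 t"
proof -
  have mem: "B \<in> circ t" "C \<in> circ t" and st: "mobius_step C A"
    using assms mobius_step_mem_circ mobius_step_cycle by blast+
  have "is_brocard_point1 A B C (t / 2) (focus1 t)" "is_brocard_point2 A B C (t / 2) (focus2 t)"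
    using assms mem st by (simp_all add: is_brocard_point1_def is_brocard_point2_def
        oangle_focus1 oangle_focus2)
  then show "brocard_angle A B C = t / 2" "brocard_point1 A B C = focus1 t"
    "brocard_point2 A B C = focus2 t"
    using brocard_eqI mobius_step_ccw[OF assms] by blast+
qed

section \<open>Brocard circle and porism\<close>

lemma brocard_circle_foci:
  defines "X \<equiv> Complex 0 ((cos t - 2) / (2 * sin t))" and "r \<equiv> (2 * cos t - 1) / (2 * sin t)"
  shows "circumcenter (circ_center t) (focus1 t) (focus2 t) = X"
    "circumcircle (circ_center t) (focus1 t) (focus2 t) = sphere X r"
proof -
  have r: "0 < r"
    using trig_bounds by (simp add: r_def)
  have X: "2 * sin t * Im X = cos t - 2" "Re X = 0" and rs: "2 * sin t * r = 2 * cos t - 1"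
    using trig_bounds by (simp_all add: X_def r_def)
  have sc: "(sin t)\<^sup>2 + (cos t)\<^sup>2 = 1" by simp
  have s0: "4 * (sin t)\<^sup>2 \<noteq> 0"
    using trig_bounds by simp
  \<comment> \<open>The factor \<open>4 * (sin t)\<^sup>2\<close> clears the denominators of
    \<open>X\<close> and \<open>r\<close>. One equation serves both foci, which are symmetric about
    the imaginary axis.\<close>
  have F: "4 * (sin t)\<^sup>2 * ((1 / 2 - cos t)\<^sup>2 + (- sin t - Im X)\<^sup>2) = 4 * (sin t)\<^sup>2 * r\<^sup>2"
    using X(1) rs sc by algebra
  have C: "4 * (sin t)\<^sup>2 * (k - Im X)\<^sup>2 = 4 * (sin t)\<^sup>2 * r\<^sup>2"
    using X(1) rs k_sin by algebra
  have "(dist X P)\<^sup>2 = r\<^sup>2" if "P \<in> {circ_center t, focus1 t, focus2 t}" for P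
    using that F C s0 X(2)
    by (auto simp: dist_complex_def cmod_power2 circ_center_eq focus_eq power2_commute)
  then have sub: "{circ_center t, focus1 t, focus2 t} \<subseteq> sphere X r"
    using r by (auto simp: power2_eq_iff_nonneg)
  have ne: "circ_center t \<noteq> focus1 t" "circ_center t \<noteq> focus2 t" "focus1 t \<noteq> focus2 t"
    using trig_bounds by (auto simp: circ_center_eq focus_eq complex_eq_iff)
  note nz = cross_sphere_nonzero[OF sub ne]
  show "circumcenter (circ_center t) (focus1 t) (focus2 t) = X"
    "circumcircle (circ_center t) (focus1 t) (focus2 t) = sphere X r"
    using circumcircle_eqI[OF nz sub] .
qed

lemma brocard_inellipse:
  assumes "three_periodic (circ t) (ell t) A B C"
  shows "is_brocard_inellipse A B C (ell t)"
proof -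
  have "A \<in> circ t" "mobius_step A B" "mobius_step B C"
    using assms by (simp_all add: three_periodic_iff)
  then show ?thesis
    using assms by (simp add: is_brocard_inellipse_def brocard_eq ell_foci three_periodic_def)
qed

lemma ex_three_periodic:
  assumes "A \<in> circ t"
  shows "\<exists>B C. three_periodic (circ t) (ell t) A B C"
proof -
  obtain B where "mobius_step A B"
    using ex_mobius_step assms by blast
  moreover from this obtain C where "mobius_step B C"
    using ex_mobius_step mobius_step_mem_circ assms by blast
  ultimately show ?thesis
    using assms by (auto simp: three_periodic_iff)
qed

lemma porism: "brocard_porism (circ t) (ell t)"
proof -
  \<comment> \<open>The rightmost point of the circle, as an arbitrary starting vertex.\<close>
  have "circ_center t + of_real (circ_radius t) \<in> circ t"
    using circ_radius_sq(2) by (simp add: circ_def dist_norm)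
  then obtain A B C where T: "three_periodic (circ t) (ell t) A B C"
    using ex_three_periodic by blast
  then have "circumcircle A B C = circ t" "ccw_triangle A B C"
    using circumcircle_eq mobius_step_ccw by (simp_all add: three_periodic_iff)
  then show ?thesis
    using brocard_inellipse[OF T] unfolding brocard_porism_def by metis
qed

end

section \<open>Continuity in the parameter and conclusion\<close>

lemma continuous_parameters:
  "continuous_on S ell_center" "continuous_on S ell_a" "continuous_on S ell_b"
  "continuous_on S focus1" "continuous_on S focus2"
  "continuous_on {0<..pi/3} circ_center" "continuous_on {0<..pi/3} circ_radius"
proof -
  show c: "continuous_on S ell_center" and a: "continuous_on S ell_a" and b: "continuous_on S ell_b"
    unfolding ell_center_def ell_a_def ell_b_def Complex_eq
    by (intro continuous_intros; simp)+
  show "continuous_on S focus1" "continuous_on S focus2"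
    unfolding focus1_def focus2_def by (intro continuous_intros a b c)+
  \<comment> \<open>The denominators of the circle's parameters vanish at 0, hence the half-open
    interval.\<close>
  have "cos x \<noteq> 1" if "x \<in> {0<..pi/3}" for x :: real
    using that cos_monotone_0_pi[of 0 x] by simp
  then show "continuous_on {0<..pi/3} circ_center" "continuous_on {0<..pi/3} circ_radius"
    unfolding circ_center_def circ_radius_def Complex_eq
    by (intro continuous_intros; force)+
qed

theorem theorem4:
  shows "continuous_on {0..pi/3} ell_center \<and> continuous_on {0..pi/3} ell_a \<and>
    continuous_on {0..pi/3} ell_b \<and> continuous_on {0..pi/3} focus1 \<and>
    continuous_on {0..pi/3} focus2 \<and>
    continuous_on {0<..pi/3} circ_center \<and> continuous_on {0<..pi/3} circ_radius \<and>
    (\<forall>t \<in> {0<..<pi/3}.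
       ellipse_with_foci (ell t) (focus1 t) (focus2 t) \<and>
       brocard_porism (circ t) (ell t) \<and>
       (\<forall>A \<in> circ t. \<exists>B C. three_periodic (circ t) (ell t) A B C) \<and>
       (\<forall>A B C. three_periodic (circ t) (ell t) A B C \<longrightarrow>
          circumcenter A B C = circ_center t \<and>
          circumcircle A B C = circ t \<and>
          is_brocard_inellipse A B C (ell t) \<and>
          brocard_point1 A B C = focus1 t \<and>
          brocard_point2 A B C = focus2 t \<and>
          isodynamic_points A B C = {Complex 0 (- sqrt 3 / 2), Complex 0 (sqrt 3 / 2)} \<and>
          X15 A B C = Complex 0 (- sqrt 3 / 2) \<and>
          X16 A B C = Complex 0 (sqrt 3 / 2) \<and>
          brocard_angle A B C = t / 2 \<and>
          X182 A B C = Complex 0 ((cos t - 2) / (2 * sin t)) \<and>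
          brocard_circle A B C =
            sphere (Complex 0 ((cos t - 2) / (2 * sin t))) ((2 * cos t - 1) / (2 * sin t))))"
proof (intro conjI continuous_parameters ballI)
  fix t :: real assume "t \<in> {0<..<pi/3}"
  then interpret brocard_family t
    by unfold_locales auto
  show "ellipse_with_foci (ell t) (focus1 t) (focus2 t)"
    by (rule ell_foci)
  show "brocard_porism (circ t) (ell t)"
    by (rule porism)
  show "\<exists>B C. three_periodic (circ t) (ell t) A B C" if "A \<in> circ t" for A
    using that by (rule ex_three_periodic)
  show "\<forall>A B C. three_periodic (circ t) (ell t) A B C \<longrightarrow>
          circumcenter A B C = circ_center t \<and>
          circumcircle A B C = circ t \<and>
          is_brocard_inellipse A B C (ell t) \<and>
          brocard_point1 A B C = focus1 t \<and>
          brocard_point2 A B C = focus2 t \<and>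
          isodynamic_points A B C = {Complex 0 (- sqrt 3 / 2), Complex 0 (sqrt 3 / 2)} \<and>
          X15 A B C = Complex 0 (- sqrt 3 / 2) \<and>
          X16 A B C = Complex 0 (sqrt 3 / 2) \<and>
          brocard_angle A B C = t / 2 \<and>
          X182 A B C = Complex 0 ((cos t - 2) / (2 * sin t)) \<and>
          brocard_circle A B C =
            sphere (Complex 0 ((cos t - 2) / (2 * sin t))) ((2 * cos t - 1) / (2 * sin t))"
  proof (intro allI impI)
    fix A B C assume T: "three_periodic (circ t) (ell t) A B C"
    then have ABC: "A \<in> circ t" "mobius_step A B" "mobius_step B C"
      by (simp_all add: three_periodic_iff)
    show "circumcenter A B C = circ_center t \<and>
          circumcircle A B C = circ t \<and>
          is_brocard_inellipse A B C (ell t) \<and>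
          brocard_point1 A B C = focus1 t \<and>
          brocard_point2 A B C = focus2 t \<and>
          isodynamic_points A B C = {Complex 0 (- sqrt 3 / 2), Complex 0 (sqrt 3 / 2)} \<and>
          X15 A B C = Complex 0 (- sqrt 3 / 2) \<and>
          X16 A B C = Complex 0 (sqrt 3 / 2) \<and>
          brocard_angle A B C = t / 2 \<and>
          X182 A B C = Complex 0 ((cos t - 2) / (2 * sin t)) \<and>
          brocard_circle A B C =
            sphere (Complex 0 ((cos t - 2) / (2 * sin t))) ((2 * cos t - 1) / (2 * sin t))"
      unfolding X182_def brocard_circle_def circumcircle_eq[OF ABC] brocard_eq[OF ABC]
        isodynamic_points_eq[OF ABC] X15_X16_eq[OF ABC] brocard_circle_foci
      using brocard_inellipse[OF T] by simp
  qed
qed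

end
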